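(* Let $G$ be a unicyclic graph with cycle $C=(v_0,\dots,v_{g-1})$, $g\ge 3$, and cycle edges $c_j=\{v_{j-1},v_j\}$ ($j=1,\dots,g$, indices mod $g$). (1) Let $w:E\to\mathbb{R}_{>0}$ be an edge weighting with cycle perimeter $L=\sum_j w(c_j)$ that is geodesic, i.e. $w(c_i)\le L/2$ for every $i$. Then a cycle edge $c_j$ obeys the tree formula if and only if $$w(c_{j-1})+w(c_j)+w(c_{j+1})\le \tfrac{L}{2},$$ while every pendant (non-cycle) edge obeys the tree formula. (2) Consequently, let $w^\ast>0$ be the Perron eigenvector of the Ricci matrix $R_G$, with eigenvalue $\lambda_{\max}(R_G)$, and let $L^\ast=\sum_j w^\ast(c_j)$. Then $w^\ast$ is a discrete Einstein metric with constant curvature $\kappa=-\lambda_{\max}(R_G)$ if and only if $w^\ast(c_{j-1})+w^\ast(c_j)+w^\ast(c_{j+1})\le L^\ast/2$ for every $j$. When this holds, the discrete Einstein metric on $G$ is unique up to scaling.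
   Context: Weighted graphs: $G=(V,E)$ is a finite connected simple graph, $w:E\to\mathbb{R}_{>0}$, $w_{xy}=w(\{x,y\})$, $d_v$ is the combinatorial degree, $S_v=\sum_{u\sim v}w_{vu}$, and $d(x,y)$ is the least total weight of a path from $x$ to $y$. Lin--Lu--Yau curvature: for $\alpha\in[0,1]$ let $\mu_x^\alpha$ be the probability measure with mass $\alpha$ at $x$ and $(1-\alpha)/d_x$ at each neighbour of $x$. Let $W$ be the $L^1$-Wasserstein distance with respect to $d$. For an edge $x\sim y$ put $\kappa_\alpha(x,y)=1-W(\mu_x^\alpha,\mu_y^\alpha)/d(x,y)$ and $\kappa_{xy}=\lim_{\alpha\to1}\kappa_\alpha(x,y)/(1-\alpha)$. A positive weighting $w$ is a discrete Einstein metric of curvature $\kappa$ if $\kappa_e=\kappa$ for every edge $e$. Tree formula: an edge $\{x,y\}$ obeys the tree formula if $$\kappa_{xy}=-\Big(\frac{S_x-2w_{xy}}{w_{xy}d_x}+\frac{S_y-2w_{xy}}{w_{xy}d_y}\Big).$$ Ricci matrix: $R_G\in\mathbb{R}^{E\times E}$ has diagonal entries $-(1/d_x+1/d_y)$ for $e=\{x,y\}$, entry $1/d_z$ for $e\ne e'$ with $e\cap e'=\{z\}$, and $0$ for disjoint edges. $R_G+2I$ is nonnegative and irreducible, so the largest eigenvalue $\lambda_{\max}(R_G)$ is simple with a positive (Perron) eigenvector, unique up to scaling. Unicyclic: connected with $|E|=|V|$, i.e. containing exactly one cycle; $G$ is a cycle with rooted trees (possibly trivial) attached at cycle vertices. 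*)

theory Defs
  imports "HOL-Probability.Probability"
begin

text \<open>A finite simple graph is given by its vertex set and its set of two-element edges; vectors
  indexed by the edges are functions on edges, of which only the values on the edge set matter.\<close>

definition simple_graph :: "'a set \<Rightarrow> 'a set set \<Rightarrow> bool" where
  "simple_graph V E \<longleftrightarrow> finite V \<and> (\<forall>e\<in>E. e \<subseteq> V \<and> card e = 2)"

definition is_path :: "'a set set \<Rightarrow> 'a \<Rightarrow> 'a list \<Rightarrow> 'a \<Rightarrow> bool" where
  "is_path E x p y \<longleftrightarrow>
     p \<noteq> [] \<and> hd p = x \<and> last p = y \<and> distinct p \<and> successively (\<lambda>a b. {a, b} \<in> E) p"

definition connected_graph :: "'a set \<Rightarrow> 'a set set \<Rightarrow> bool" where
  "connected_graph V E \<longleftrightarrow> V \<noteq> {} \<and> (\<forall>x\<in>V. \<forall>y\<in>V. \<exists>p. is_path E x p y)"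

definition unicyclic :: "'a set \<Rightarrow> 'a set set \<Rightarrow> bool" where
  "unicyclic V E \<longleftrightarrow> simple_graph V E \<and> connected_graph V E \<and> card E = card V"

definition nbrs :: "'a set set \<Rightarrow> 'a \<Rightarrow> 'a set" where
  "nbrs E x = {y. {x, y} \<in> E}"

definition deg :: "'a set set \<Rightarrow> 'a \<Rightarrow> nat" where
  "deg E x = card (nbrs E x)"

definition strength :: "'a set set \<Rightarrow> ('a set \<Rightarrow> real) \<Rightarrow> 'a \<Rightarrow> real" where
  "strength E w x = (\<Sum>u\<in>nbrs E x. w {x, u})"

definition positive_weighting :: "'a set set \<Rightarrow> ('a set \<Rightarrow> real) \<Rightarrow> bool" where
  "positive_weighting E w \<longleftrightarrow> (\<forall>e\<in>E. w e > 0)"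

definition path_weight :: "('a set \<Rightarrow> real) \<Rightarrow> 'a list \<Rightarrow> real" where
  "path_weight w p = (\<Sum>i<length p - 1. w {p ! i, p ! Suc i})"

definition graph_dist :: "'a set set \<Rightarrow> ('a set \<Rightarrow> real) \<Rightarrow> 'a \<Rightarrow> 'a \<Rightarrow> real" where
  "graph_dist E w x y = Min {path_weight w p | p. is_path E x p y}"

definition wasserstein :: "('a \<Rightarrow> 'a \<Rightarrow> real) \<Rightarrow> 'a pmf \<Rightarrow> 'a pmf \<Rightarrow> real" where
  "wasserstein d \<mu> \<nu> =
     Inf {measure_pmf.expectation \<pi> (\<lambda>(u, v). d u v) | \<pi>. map_pmf fst \<pi> = \<mu> \<and> map_pmf snd \<pi> = \<nu>}"

definition lazy_measure :: "'a set set \<Rightarrow> real \<Rightarrow> 'a \<Rightarrow> 'a pmf" where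
  "lazy_measure E \<alpha> x =
     bind_pmf (bernoulli_pmf \<alpha>) (\<lambda>stay. if stay then return_pmf x else pmf_of_set (nbrs E x))"

lemma pmf_lazy_measure:
  assumes "simple_graph V E" "nbrs E x \<noteq> {}" "0 \<le> \<alpha>" "\<alpha> \<le> 1"
  shows "pmf (lazy_measure E \<alpha> x) z =
           (if z = x then \<alpha> else if z \<in> nbrs E x then (1 - \<alpha>) / deg E x else 0)"
proof -
  have "nbrs E x \<subseteq> V" and x: "x \<notin> nbrs E x"
    using assms(1) by (auto simp: simple_graph_def nbrs_def)
  then have "finite (nbrs E x)"
    using assms(1) finite_subset by (auto simp: simple_graph_def)
  with assms x show ?thesis
    by (auto simp: lazy_measure_def pmf_bind deg_def indicator_def)
qed

definition lly_alpha_curvature ::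
    "'a set set \<Rightarrow> ('a set \<Rightarrow> real) \<Rightarrow> real \<Rightarrow> 'a \<Rightarrow> 'a \<Rightarrow> real" where
  "lly_alpha_curvature E w \<alpha> x y =
     1 - wasserstein (graph_dist E w) (lazy_measure E \<alpha> x) (lazy_measure E \<alpha> y) / graph_dist E w x y"

definition lly_curvature :: "'a set set \<Rightarrow> ('a set \<Rightarrow> real) \<Rightarrow> 'a \<Rightarrow> 'a \<Rightarrow> real" where
  "lly_curvature E w x y = Lim (at_left 1) (\<lambda>\<alpha>. lly_alpha_curvature E w \<alpha> x y / (1 - \<alpha>))"

definition discrete_einstein :: "'a set set \<Rightarrow> ('a set \<Rightarrow> real) \<Rightarrow> real \<Rightarrow> bool" where
  "discrete_einstein E w \<kappa> \<longleftrightarrow>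
     positive_weighting E w \<and> (\<forall>x y. {x, y} \<in> E \<longrightarrow> lly_curvature E w x y = \<kappa>)"

definition obeys_tree_formula :: "'a set set \<Rightarrow> ('a set \<Rightarrow> real) \<Rightarrow> 'a \<Rightarrow> 'a \<Rightarrow> bool" where
  "obeys_tree_formula E w x y \<longleftrightarrow>
     lly_curvature E w x y =
       - ((strength E w x - 2 * w {x, y}) / (w {x, y} * deg E x)
        + (strength E w y - 2 * w {x, y}) / (w {x, y} * deg E y))"

text \<open>Distinct edges share at most one vertex, so the second sum below is the reciprocal of the
  degree of the common vertex, or zero for disjoint edges.\<close>

definition ricci_matrix :: "'a set set \<Rightarrow> 'a set \<Rightarrow> 'a set \<Rightarrow> real" where
  "ricci_matrix E e e' =
     (if e = e' then - (\<Sum>z\<in>e. 1 / deg E z) else (\<Sum>z\<in>e \<inter> e'. 1 / deg E z))"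

definition ricci_eigenvector :: "'a set set \<Rightarrow> ('a set \<Rightarrow> real) \<Rightarrow> real \<Rightarrow> bool" where
  "ricci_eigenvector E u k \<longleftrightarrow>
     (\<exists>e\<in>E. u e \<noteq> 0) \<and> (\<forall>e\<in>E. (\<Sum>e'\<in>E. ricci_matrix E e e' * u e') = k * u e)"

text \<open>The matrix is symmetric, so all of its eigenvalues are real.\<close>

definition ricci_lambda_max :: "'a set set \<Rightarrow> real" where
  "ricci_lambda_max E = Max {k. \<exists>u. ricci_eigenvector E u k}"

definition perron_eigenvector :: "'a set set \<Rightarrow> ('a set \<Rightarrow> real) \<Rightarrow> bool" where
  "perron_eigenvector E u \<longleftrightarrow>
     positive_weighting E u \<and> ricci_eigenvector E u (ricci_lambda_max E)"

text \<open>A cycle is the list of its vertices, and its indices are integers modulo its length.\<close>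

definition cyc_vertex :: "'a list \<Rightarrow> int \<Rightarrow> 'a" where
  "cyc_vertex C j = C ! nat (j mod int (length C))"

definition cyc_edge :: "'a list \<Rightarrow> int \<Rightarrow> 'a set" where
  "cyc_edge C j = {cyc_vertex C (j - 1), cyc_vertex C j}"

definition is_cycle :: "'a set set \<Rightarrow> 'a list \<Rightarrow> bool" where
  "is_cycle E C \<longleftrightarrow>
     length C \<ge> 3 \<and> distinct C \<and> (\<forall>j\<in>{1..int (length C)}. cyc_edge C j \<in> E)"

definition perimeter :: "'a list \<Rightarrow> ('a set \<Rightarrow> real) \<Rightarrow> real" where
  "perimeter C w = (\<Sum>j\<in>{1..int (length C)}. w (cyc_edge C j))"

definition geodesic_weighting :: "'a list \<Rightarrow> ('a set \<Rightarrow> real) \<Rightarrow> bool" where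
  "geodesic_weighting C w \<longleftrightarrow> (\<forall>i\<in>{1..int (length C)}. w (cyc_edge C i) \<le> perimeter C w / 2)"

definition three_edge_condition :: "'a list \<Rightarrow> ('a set \<Rightarrow> real) \<Rightarrow> int \<Rightarrow> bool" where
  "three_edge_condition C w j \<longleftrightarrow>
     w (cyc_edge C (j - 1)) + w (cyc_edge C j) + w (cyc_edge C (j + 1)) \<le> perimeter C w / 2"

end

theory Submission
  imports Defs
begin

text \<open>Every coupling bounds the curvature of an edge from below, and every function that is 1-Lipschitz
  along edges bounds it from above. Moving the neighbours of \<open>x\<close> to \<open>y\<close> and \<open>x\<close> to the neighbours of \<open>y\<close>
  shows that the curvature is at least the tree formula. The bound is sharp if and only if there is a
  potential decreasing along all edges at \<open>x\<close> and increasing along all edges at \<open>y\<close>. Across a pendant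
  edge, which is a bridge, such a potential always exists. Across a cycle edge it exists if the three
  consecutive edges form a geodesic, and otherwise transporting the outer end points along the
  complementary arc is strictly cheaper.

  For two weightings, compare edge lengths: at an edge where the ratio \<open>d/d'\<close> is maximal, scaling gives
  \<open>W / d \<le> W' / d'\<close>, so the curvature of \<open>d\<close> is at least that of \<open>d'\<close>. Hence all Einstein metrics have the same
  curvature. If it equals the negative of the Perron eigenvalue, the lower bound says that the edge
  lengths form a positive supersolution of the eigenvalue equation, hence a multiple of the Perron
  eigenvector. The edge lengths can differ from the weights only at a cycle edge longer than the
  rest of the cycle; there the edge length would be half of the perimeter, against the three-edge
  condition.\<close>

section \<open>The path metric of a weighted graph\<close>

lemma path_weight_simps [simp]:
  "path_weight w [] = 0"
  "path_weight w [x] = 0"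
  "path_weight w (x # y # p) = w {x, y} + path_weight w (y # p)"
  by (simp_all add: path_weight_def sum.lessThan_Suc_shift del: sum.lessThan_Suc)

lemma path_weight_append:
  "p \<noteq> [] \<Longrightarrow> path_weight w (p @ q) = path_weight w p + path_weight w (last p # q)"
  by (induction p rule: induct_list012) auto

lemma path_weight_rev: "path_weight w (rev p) = path_weight w p"
proof (induction p rule: induct_list012)
  case (3 x y zs)
  then show ?case
    using path_weight_append[of "rev zs @ [y]" w "[x]"] by (simp add: insert_commute)
qed simp_all

lemma is_path_rev:
  assumes "is_path E x p y" shows "is_path E y (rev p) x"
  using assms by (auto simp: is_path_def hd_rev last_rev insert_commute cong del: successively_cong)

text \<open>Edges are unordered, so both orientations are covered and the one-sided bound controls
  the absolute difference.\<close>

definition edge_lipschitz :: "'a set set \<Rightarrow> ('a set \<Rightarrow> real) \<Rightarrow> ('a \<Rightarrow> real) \<Rightarrow> bool" where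
  "edge_lipschitz E w f \<longleftrightarrow> (\<forall>a b. {a, b} \<in> E \<longrightarrow> f b - f a \<le> w {a, b})"

lemma edge_lipschitzD: "edge_lipschitz E w f \<Longrightarrow> {a, b} \<in> E \<Longrightarrow> f b - f a \<le> w {a, b}"
  by (simp add: edge_lipschitz_def)

lemma edge_lipschitz_path_weight:
  assumes "edge_lipschitz E w f"
  shows "successively (\<lambda>a b. {a, b} \<in> E) p \<Longrightarrow> p \<noteq> [] \<Longrightarrow> f (last p) - f (hd p) \<le> path_weight w p"
  by (induction p rule: induct_list012) (use assms in \<open>auto simp: edge_lipschitz_def, smt (verit)\<close>)

locale conn_graph =
  fixes V :: "'a set" and E :: "'a set set"
  assumes simple: "simple_graph V E" and conn: "connected_graph V E"
begin

lemma finite_V: "finite V"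
  using simple by (simp add: simple_graph_def)

lemma finite_E: "finite E"
  using simple by (auto simp: simple_graph_def intro: finite_subset[of E "Pow V"])

lemma edge_in_V: "{x, y} \<in> E \<Longrightarrow> x \<in> V" "{x, y} \<in> E \<Longrightarrow> y \<in> V"
  using simple by (auto simp: simple_graph_def)

lemma edge_neq: "{x, y} \<in> E \<Longrightarrow> x \<noteq> y"
  using simple by (auto simp: simple_graph_def)

lemma edgeE:
  assumes "e \<in> E" obtains x y where "e = {x, y}" "x \<noteq> y" "{x, y} \<in> E"
  using simple assms by (metis card_2_iff simple_graph_def)

lemma edge_commute: "{x, y} \<in> E \<longleftrightarrow> {y, x} \<in> E"
  by (simp add: insert_commute)

lemma in_nbrs: "y \<in> nbrs E x \<longleftrightarrow> {x, y} \<in> E"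
  by (simp add: nbrs_def)

lemma nbrs_subset: "nbrs E x \<subseteq> V"
  using edge_in_V by (auto simp: nbrs_def)

lemma finite_nbrs: "finite (nbrs E x)"
  using nbrs_subset finite_V finite_subset by blast

lemma deg_pos: "{x, y} \<in> E \<Longrightarrow> deg E x > 0"
  using finite_nbrs by (auto simp: deg_def card_gt_0_iff in_nbrs)

lemma path_in_V:
  "successively (\<lambda>a b. {a, b} \<in> E) p \<Longrightarrow> p \<noteq> [] \<Longrightarrow> set p \<subseteq> insert (hd p) V"
  by (induction p rule: induct_list012) (use edge_in_V in auto)

lemma finite_paths: "finite {p. is_path E x p y}"
proof (rule finite_subset)
  show "{p. is_path E x p y} \<subseteq> {p. set p \<subseteq> insert x V \<and> distinct p}"
    using path_in_V by (auto simp: is_path_def)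
  show "finite {p. set p \<subseteq> insert x V \<and> distinct p}"
    using finite_V by (intro finite_subset_distinct) simp
qed

end

locale weighted_graph = conn_graph +
  fixes w :: "'a set \<Rightarrow> real"
  assumes pos: "positive_weighting E w"
begin

abbreviation d :: "'a \<Rightarrow> 'a \<Rightarrow> real" where "d \<equiv> graph_dist E w"

lemma w_pos: "e \<in> E \<Longrightarrow> w e > 0"
  using pos by (simp add: positive_weighting_def)

lemma path_weight_nonneg:
  "successively (\<lambda>a b. {a, b} \<in> E) p \<Longrightarrow> path_weight w p \<ge> 0"
  by (induction p rule: induct_list012) (use w_pos in \<open>auto intro!: add_nonneg_nonneg intro: less_imp_le\<close>)

lemma d_le_path: "is_path E x p y \<Longrightarrow> d x y \<le> path_weight w p"
  unfolding graph_dist_def using finite_paths[of x y]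
  by (intro Min_le) (auto simp: setcompr_eq_image)

lemma shortest_pathE:
  assumes "x \<in> V" "y \<in> V"
  obtains p where "is_path E x p y" "d x y = path_weight w p"
proof -
  have "{path_weight w p | p. is_path E x p y} \<noteq> {}"
    using conn assms by (auto simp: connected_graph_def)
  then have "d x y \<in> {path_weight w p | p. is_path E x p y}"
    unfolding graph_dist_def using finite_paths[of x y]
    by (intro Min_in) (auto simp: setcompr_eq_image)
  then show ?thesis using that by auto
qed

text \<open>Telescoping along a shortest path. All lower bounds on distances below come from a
  suitable test function \<open>f\<close>.\<close>

lemma d_ge_lipschitz:
  assumes "edge_lipschitz E w f" "x \<in> V" "y \<in> V"
  shows "f y - f x \<le> d x y"
proof -
  obtain p where p: "is_path E x p y" "d x y = path_weight w p"
    using shortest_pathE assms by blast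
  then show ?thesis
    using edge_lipschitz_path_weight[OF assms(1), of p] by (auto simp: is_path_def)
qed

lemma d_commute: assumes "x \<in> V" "y \<in> V" shows "d x y = d y x"
proof -
  have "d b a \<le> d a b" if ab: "a \<in> V" "b \<in> V" for a b
  proof -
    obtain p where "is_path E a p b" "d a b = path_weight w p"
      by (rule shortest_pathE[OF ab])
    then show ?thesis using d_le_path is_path_rev path_weight_rev by metis
  qed
  then show ?thesis using assms by (simp add: antisym)
qed

lemma d_nonneg: assumes "x \<in> V" "y \<in> V" shows "d x y \<ge> 0"
proof -
  have "edge_lipschitz E w (\<lambda>_. 0)" using w_pos by (auto simp: edge_lipschitz_def less_imp_le)
  from d_ge_lipschitz[OF this assms] show ?thesis by simp
qed

lemma d_self [simp]: assumes "x \<in> V" shows "d x x = 0"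
  using d_nonneg[OF assms assms] d_le_path[of x "[x]" x] by (simp add: is_path_def)

lemma d_le_edge: assumes "{x, y} \<in> E" shows "d x y \<le> w {x, y}"
  using d_le_path[of x "[x, y]" y] assms edge_neq by (simp add: is_path_def)

text \<open>Paths have distinct vertices, so an edge cannot always be appended. If \<open>b\<close>
  already lies on the shortest path to \<open>a\<close>, cutting the path at \<open>b\<close> only
  lowers its weight. The triangle inequality then follows because \<open>d x\<close> is itself a
  Lipschitz function.\<close>

lemma d_extend: assumes "x \<in> V" "{a, b} \<in> E" shows "d x b \<le> d x a + w {a, b}"
proof -
  obtain p where p: "is_path E x p a" "d x a = path_weight w p"
    using shortest_pathE assms edge_in_V by blast
  show ?thesis
  proof (cases "b \<in> set p")
    case False
    then have "is_path E x (p @ [b]) b"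
      using p assms by (auto simp: is_path_def successively_append_iff)
    moreover have "path_weight w (p @ [b]) = d x a + w {a, b}"
      using p by (simp add: path_weight_append is_path_def)
    ultimately show ?thesis using d_le_path by metis
  next
    case True
    then obtain q r where qr: "p = (q @ [b]) @ r" by (metis append.assoc append_Cons append_Nil split_list)
    have s: "successively (\<lambda>a b. {a, b} \<in> E) (q @ [b])" "successively (\<lambda>a b. {a, b} \<in> E) (b # r)"
      using p unfolding qr is_path_def by (auto simp: successively_append_iff successively_Cons)
    have "is_path E x (q @ [b]) b"
      using p s unfolding qr is_path_def by (auto simp: hd_append)
    moreover have "path_weight w p = path_weight w (q @ [b]) + path_weight w (b # r)"
      unfolding qr by (subst path_weight_append) auto
    moreover have "path_weight w (b # r) \<ge> 0" using s path_weight_nonneg by blast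
    ultimately show ?thesis using d_le_path[of x "q @ [b]" b] p w_pos[OF assms(2)] by linarith
  qed
qed

lemma d_edge_lipschitz: "x \<in> V \<Longrightarrow> edge_lipschitz E w (d x)"
  unfolding edge_lipschitz_def using d_extend by (simp add: algebra_simps)

lemma d_triangle: "x \<in> V \<Longrightarrow> y \<in> V \<Longrightarrow> z \<in> V \<Longrightarrow> d x z \<le> d x y + d y z"
  using d_ge_lipschitz[OF d_edge_lipschitz, of x y z] by simp

text \<open>The test function is \<open>m\<close> at \<open>y\<close> and 0 elsewhere. This yields
  positivity of distances, and later that a lightest edge is a shortest path.\<close>

lemma d_ge_min:
  assumes "\<And>e. e \<in> E \<Longrightarrow> m \<le> w e" "m \<ge> 0" "x \<in> V" "y \<in> V" "x \<noteq> y"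
  shows "m \<le> d x y"
proof -
  have "edge_lipschitz E w (\<lambda>z. if z = y then m else 0)"
    using assms(1,2) w_pos by (force simp: edge_lipschitz_def)
  from d_ge_lipschitz[OF this assms(3,4)] show ?thesis using assms(5) by simp
qed

lemma d_pos: assumes "x \<in> V" "y \<in> V" "x \<noteq> y" shows "d x y > 0"
proof (cases "E = {}")
  case True
  obtain p where p: "is_path E x p y" using shortest_pathE assms by blast
  with assms True show ?thesis
    by (cases p rule: remdups_adj.cases) (auto simp: is_path_def)
next
  case False
  then have "Min (w ` E) > 0" using finite_E w_pos by (simp add: Min_gr_iff)
  moreover have "Min (w ` E) \<le> w e" if "e \<in> E" for e using that finite_E by simp
  ultimately show ?thesis using d_ge_min[of "Min (w ` E)" x y] assms by fastforce
qed

end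

section \<open>Transport between lazy measures\<close>

definition mix_pmf :: "real \<Rightarrow> 'a pmf \<Rightarrow> 'a pmf \<Rightarrow> 'a pmf" where
  "mix_pmf p M N = bind_pmf (bernoulli_pmf p) (\<lambda>b. if b then M else N)"

lemma pmf_mix_pmf:
  assumes "0 \<le> p" "p \<le> 1"
  shows "pmf (mix_pmf p M N) z = p * pmf M z + (1 - p) * pmf N z"
  using assms by (simp add: mix_pmf_def pmf_bind)

lemma expectation_mix_pmf:
  fixes h :: "'a \<Rightarrow> real"
  assumes "0 \<le> p" "p \<le> 1" "finite (set_pmf M)" "finite (set_pmf N)"
  shows "measure_pmf.expectation (mix_pmf p M N) h =
    p * measure_pmf.expectation M h + (1 - p) * measure_pmf.expectation N h"
  unfolding mix_pmf_def using assms
  by (subst pmf_expectation_bind[where A = UNIV]) (auto simp: UNIV_bool)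

lemma map_mix_pmf: "map_pmf f (mix_pmf p M N) = mix_pmf p (map_pmf f M) (map_pmf f N)"
  unfolding mix_pmf_def map_bind_pmf by (rule bind_pmf_cong) auto

lemma set_mix_pmf: "set_pmf (mix_pmf p M N) \<subseteq> set_pmf M \<union> set_pmf N"
  by (auto simp: mix_pmf_def split: if_splits)

text \<open>Drawing \<open>u\<close> from \<open>M\<close> and then replacing it by \<open>x\<close>
  with probability \<open>1 - p\<close> commutes with deciding on the replacement first; this
  computes the marginals of the coupling built below.\<close>

lemma bind_mix_return_pmf:
  "bind_pmf M (\<lambda>u. mix_pmf p (return_pmf u) (return_pmf x)) = mix_pmf p M (return_pmf x)"
proof -
  have "bind_pmf M (\<lambda>u. mix_pmf p (return_pmf u) (return_pmf x)) =
    bind_pmf (bernoulli_pmf p) (\<lambda>b. bind_pmf M (\<lambda>u. if b then return_pmf u else return_pmf x))"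
    unfolding mix_pmf_def by (rule bind_commute_pmf)
  also have "\<dots> = mix_pmf p M (return_pmf x)"
    unfolding mix_pmf_def by (rule bind_pmf_cong) (auto simp: bind_return_pmf' bind_pmf_const)
  finally show ?thesis .
qed

lemma lazy_measure_mix: "lazy_measure E \<alpha> x = mix_pmf \<alpha> (return_pmf x) (pmf_of_set (nbrs E x))"
  by (simp add: lazy_measure_def mix_pmf_def)

text \<open>Raising the laziness from \<beta> to \<alpha> only mixes in a point mass at the centre,
  so a coupling for \<beta> can be diluted to one for \<alpha>.\<close>

lemma lazy_measure_lazier:
  assumes "0 \<le> \<beta>" "\<beta> \<le> 1" "0 \<le> s" "s \<le> 1" "1 - \<alpha> = s * (1 - \<beta>)"
  shows "mix_pmf s (lazy_measure E \<beta> x) (return_pmf x) = lazy_measure E \<alpha> x"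
proof (rule pmf_eqI)
  fix z
  have \<alpha>: "\<alpha> = 1 - s * (1 - \<beta>)" using assms(5) by simp
  have "0 \<le> s * (1 - \<beta>)" "s * (1 - \<beta>) \<le> 1" using assms by (auto intro: mult_le_one)
  then show "pmf (mix_pmf s (lazy_measure E \<beta> x) (return_pmf x)) z = pmf (lazy_measure E \<alpha> x) z"
    using assms(1-4) unfolding lazy_measure_mix \<alpha> by (simp add: pmf_mix_pmf algebra_simps)
qed

definition couplings :: "'a pmf \<Rightarrow> 'a pmf \<Rightarrow> ('a \<times> 'a) pmf set" where
  "couplings \<mu> \<nu> = {\<pi>. map_pmf fst \<pi> = \<mu> \<and> map_pmf snd \<pi> = \<nu>}"

lemma wasserstein_couplings:
  "wasserstein d \<mu> \<nu> = (INF \<pi>\<in>couplings \<mu> \<nu>. measure_pmf.expectation \<pi> (\<lambda>(u, v). d u v))"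
  by (simp add: wasserstein_def couplings_def setcompr_eq_image)

lemma couplings_nonempty: "couplings \<mu> \<nu> \<noteq> {}"
  by (auto simp: couplings_def intro!: exI[of _ "pair_pmf \<mu> \<nu>"] map_fst_pair_pmf map_snd_pair_pmf)

lemma set_coupling:
  assumes "\<pi> \<in> couplings \<mu> \<nu>" shows "set_pmf \<pi> \<subseteq> set_pmf \<mu> \<times> set_pmf \<nu>"
proof -
  have "\<mu> = map_pmf fst \<pi>" "\<nu> = map_pmf snd \<pi>"
    using assms by (auto simp: couplings_def)
  then show ?thesis by (force simp: set_map_pmf)
qed

lemma finite_coupling:
  "\<pi> \<in> couplings \<mu> \<nu> \<Longrightarrow> finite (set_pmf \<mu>) \<Longrightarrow> finite (set_pmf \<nu>) \<Longrightarrow> finite (set_pmf \<pi>)"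
  using set_coupling finite_subset finite_cartesian_product by metis

lemma wasserstein_ge:
  assumes "\<And>\<pi>. \<pi> \<in> couplings \<mu> \<nu> \<Longrightarrow> K \<le> measure_pmf.expectation \<pi> (\<lambda>(u, v). d u v)"
  shows "K \<le> wasserstein d \<mu> \<nu>"
  unfolding wasserstein_couplings using couplings_nonempty assms by (rule cINF_greatest)

lemma wasserstein_le:
  assumes "\<pi> \<in> couplings \<mu> \<nu>"
    and "\<And>u v. u \<in> set_pmf \<mu> \<Longrightarrow> v \<in> set_pmf \<nu> \<Longrightarrow> d u v \<ge> 0"
  shows "wasserstein d \<mu> \<nu> \<le> measure_pmf.expectation \<pi> (\<lambda>(u, v). d u v)"
  unfolding wasserstein_couplings
proof (rule cINF_lower[OF _ assms(1)])
  have "0 \<le> measure_pmf.expectation \<rho> (\<lambda>(u, v). d u v)" if "\<rho> \<in> couplings \<mu> \<nu>" for \<rho>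
    using set_coupling[OF that] assms(2) by (intro integral_nonneg_AE) (auto simp: AE_measure_pmf_iff)
  then show "bdd_below ((\<lambda>\<rho>. measure_pmf.expectation \<rho> (\<lambda>(u, v). d u v)) ` couplings \<mu> \<nu>)"
    by (auto intro!: bdd_belowI[of _ 0])
qed

lemma couplings_swap: "\<pi> \<in> couplings \<mu> \<nu> \<Longrightarrow> map_pmf prod.swap \<pi> \<in> couplings \<nu> \<mu>"
  by (auto simp: couplings_def pmf.map_comp comp_def)

lemma wasserstein_commute:
  assumes sym: "\<And>u v. u \<in> set_pmf \<mu> \<Longrightarrow> v \<in> set_pmf \<nu> \<Longrightarrow> d u v = d v u"
  shows "wasserstein d \<mu> \<nu> = wasserstein d \<nu> \<mu>"
proof -
  let ?cost = "\<lambda>\<pi>. measure_pmf.expectation \<pi> (\<lambda>(u, v). d u v)"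
  have "?cost ` couplings \<rho> \<sigma> \<subseteq> ?cost ` couplings \<sigma> \<rho>"
    if sym': "\<And>u v. u \<in> set_pmf \<rho> \<Longrightarrow> v \<in> set_pmf \<sigma> \<Longrightarrow> d u v = d v u" for \<rho> \<sigma>
  proof
    fix r assume "r \<in> ?cost ` couplings \<rho> \<sigma>"
    then obtain \<pi> where \<pi>: "\<pi> \<in> couplings \<rho> \<sigma>" "r = ?cost \<pi>" by auto
    have "d a b = d b a" if "(a, b) \<in> set_pmf \<pi>" for a b
      using that set_coupling[OF \<pi>(1)] by (intro sym') auto
    then have "r = ?cost (map_pmf prod.swap \<pi>)" unfolding \<pi>(2)
      by (simp add: case_prod_unfold, intro integral_cong_AE) (auto simp: AE_measure_pmf_iff)
    then show "r \<in> ?cost ` couplings \<sigma> \<rho>" using couplings_swap[OF \<pi>(1)] by blast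
  qed
  from this[of \<mu> \<nu>] this[of \<nu> \<mu>] sym have "?cost ` couplings \<mu> \<nu> = ?cost ` couplings \<nu> \<mu>"
    by (metis subset_antisym)
  then show ?thesis by (simp add: wasserstein_couplings)
qed

text \<open>The easy half of Kantorovich duality: integrate the Lipschitz bound against any
  coupling, whose support lies in the product of the two supports.\<close>

lemma wasserstein_dual:
  assumes "finite (set_pmf \<mu>)" "finite (set_pmf \<nu>)"
    and "\<And>u v. u \<in> set_pmf \<mu> \<Longrightarrow> v \<in> set_pmf \<nu> \<Longrightarrow> f v - f u \<le> d u v"
  shows "measure_pmf.expectation \<nu> f - measure_pmf.expectation \<mu> f \<le> wasserstein d \<mu> \<nu>"
proof (rule wasserstein_ge)
  fix \<pi> assume \<pi>: "\<pi> \<in> couplings \<mu> \<nu>"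
  have fin: "finite (set_pmf \<pi>)" using finite_coupling[OF \<pi> assms(1,2)] .
  have "\<mu> = map_pmf fst \<pi>" "\<nu> = map_pmf snd \<pi>" using \<pi> by (auto simp: couplings_def)
  then have "measure_pmf.expectation \<nu> f - measure_pmf.expectation \<mu> f =
      measure_pmf.expectation \<pi> (\<lambda>p. f (snd p)) - measure_pmf.expectation \<pi> (\<lambda>p. f (fst p))"
    by simp
  also have "\<dots> = measure_pmf.expectation \<pi> (\<lambda>p. f (snd p) - f (fst p))"
    using fin by (simp add: integrable_measure_pmf_finite)
  also have "\<dots> \<le> measure_pmf.expectation \<pi> (\<lambda>(u, v). d u v)"
    using fin set_coupling[OF \<pi>] assms(3)
    by (intro integral_mono_AE integrable_measure_pmf_finite) (auto simp: AE_measure_pmf_iff)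
  finally show "measure_pmf.expectation \<nu> f - measure_pmf.expectation \<mu> f \<le> measure_pmf.expectation \<pi> (\<lambda>(u, v). d u v)" .
qed

context conn_graph begin

lemma nbrs_nonempty: "{x, y} \<in> E \<Longrightarrow> nbrs E x \<noteq> {}" "{x, y} \<in> E \<Longrightarrow> nbrs E y \<noteq> {}"
  using in_nbrs edge_commute by blast+

lemma set_lazy_measure:
  assumes "nbrs E x \<noteq> {}" shows "set_pmf (lazy_measure E \<alpha> x) \<subseteq> insert x (nbrs E x)"
  unfolding lazy_measure_mix using set_mix_pmf[of \<alpha> "return_pmf x" "pmf_of_set (nbrs E x)"]
  by (simp add: assms finite_nbrs)

lemma finite_lazy_measure: "nbrs E x \<noteq> {} \<Longrightarrow> finite (set_pmf (lazy_measure E \<alpha> x))"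
  using set_lazy_measure finite_nbrs finite_subset by (metis finite_insert)

lemma lazy_measure_in_V: "nbrs E x \<noteq> {} \<Longrightarrow> x \<in> V \<Longrightarrow> set_pmf (lazy_measure E \<alpha> x) \<subseteq> V"
  using set_lazy_measure nbrs_subset by fast

lemma expectation_lazy_measure:
  fixes f :: "'a \<Rightarrow> real"
  assumes "nbrs E x \<noteq> {}" "0 \<le> \<alpha>" "\<alpha> \<le> 1"
  shows "measure_pmf.expectation (lazy_measure E \<alpha> x) f =
    \<alpha> * f x + (1 - \<alpha>) * ((\<Sum>u\<in>nbrs E x. f u) / deg E x)"
  unfolding lazy_measure_mix using assms finite_nbrs
  by (simp add: expectation_mix_pmf integral_pmf_of_set deg_def)

text \<open>Move the mass of \<open>nbrs E x\<close> to \<open>y\<close> and the mass of \<open>x\<close> to \<open>nbrs E y\<close>, except that the pairs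
  in \<open>D\<close> are served directly, the mass freed at \<open>x\<close> and \<open>y\<close> being moved from \<open>x\<close> to \<open>y\<close>.\<close>

lemma lazy_coupling:
  fixes h :: "'a \<times> 'a \<Rightarrow> real"
  assumes xy: "{x, y} \<in> E" and \<alpha>: "1 / 2 \<le> \<alpha>" "\<alpha> \<le> 1"
  obtains \<pi> where "\<pi> \<in> couplings (lazy_measure E \<alpha> x) (lazy_measure E \<alpha> y)"
    "measure_pmf.expectation \<pi> h =
      (1 - \<alpha>) / (real (deg E x) * real (deg E y)) *
        (\<Sum>p\<in>nbrs E x \<times> nbrs E y. if p \<in> D then h p + h (x, y) else h (fst p, y) + h (x, snd p))
      + (2 * \<alpha> - 1) * h (x, y)"
proof -
  define M where "M = pmf_of_set (nbrs E x)"
  define N where "N = pmf_of_set (nbrs E y)"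
  \<comment> \<open>Given an independent pair \<open>p = (u, v)\<close> of neighbours, both branches
    put mass 1/2 on \<open>u\<close> and \<open>x\<close> in the first coordinate and mass 1/2 on
    \<open>v\<close> and \<open>y\<close> in the second, so the marginals do not depend on
    \<open>D\<close>.\<close>
  define K where "K = (\<lambda>p. if p \<in> D then mix_pmf (1/2) (return_pmf p) (return_pmf (x, y))
    else mix_pmf (1/2) (return_pmf (fst p, y)) (return_pmf (x, snd p)))"
  \<comment> \<open>The kernel \<open>K\<close> moves each neighbourhood with mass 1/2, so weight
    \<open>2 * (1 - \<alpha>)\<close> gives it the required mass \<open>1 - \<alpha>\<close>. The
    rest, \<open>2 * \<alpha> - 1\<close>, goes from \<open>x\<close> to \<open>y\<close>; this is
    where \<open>1 / 2 \<le> \<alpha>\<close> enters.\<close>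
  define \<pi> where "\<pi> = mix_pmf (2 * (1 - \<alpha>)) (bind_pmf (pair_pmf M N) K) (return_pmf (x, y))"
  note ne = nbrs_nonempty[OF xy]
  have swap: "mix_pmf (1/2) P Q = mix_pmf (1/2) Q P" for P Q :: "'a pmf"
    by (rule pmf_eqI) (simp add: pmf_mix_pmf)
  have \<epsilon>: "0 \<le> 2 * (1 - \<alpha>)" "2 * (1 - \<alpha>) \<le> 1" using \<alpha> by auto
  have lazy: "mix_pmf (2 * (1 - \<alpha>)) (mix_pmf (1/2) (pmf_of_set (nbrs E z)) (return_pmf z)) (return_pmf z) =
      lazy_measure E \<alpha> z" for z
    unfolding lazy_measure_mix by (rule pmf_eqI) (use \<alpha> \<epsilon> in \<open>simp add: pmf_mix_pmf field_simps\<close>)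
  have "map_pmf fst (bind_pmf (pair_pmf M N) K) =
      bind_pmf (pair_pmf M N) (\<lambda>p. mix_pmf (1/2) (return_pmf (fst p)) (return_pmf x))"
    unfolding map_bind_pmf by (rule bind_pmf_cong) (auto simp: K_def map_mix_pmf)
  also have "\<dots> = bind_pmf (map_pmf fst (pair_pmf M N)) (\<lambda>u. mix_pmf (1/2) (return_pmf u) (return_pmf x))"
    by (simp add: bind_map_pmf)
  finally have 1: "map_pmf fst \<pi> = lazy_measure E \<alpha> x"
    unfolding \<pi>_def map_mix_pmf by (simp only: map_fst_pair_pmf bind_mix_return_pmf map_return_pmf fst_conv lazy M_def)
  have "map_pmf snd (bind_pmf (pair_pmf M N) K) =
      bind_pmf (pair_pmf M N) (\<lambda>p. mix_pmf (1/2) (return_pmf (snd p)) (return_pmf y))"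
    unfolding map_bind_pmf by (rule bind_pmf_cong) (auto simp: K_def map_mix_pmf swap[of "return_pmf y"])
  also have "\<dots> = bind_pmf (map_pmf snd (pair_pmf M N)) (\<lambda>u. mix_pmf (1/2) (return_pmf u) (return_pmf y))"
    by (simp add: bind_map_pmf)
  finally have 2: "map_pmf snd \<pi> = lazy_measure E \<alpha> y"
    unfolding \<pi>_def map_mix_pmf by (simp only: map_snd_pair_pmf bind_mix_return_pmf map_return_pmf snd_conv lazy N_def)
  have finK: "finite (set_pmf (K p))" for p
    unfolding K_def by (auto intro: finite_subset[OF set_mix_pmf])
  have EK: "measure_pmf.expectation (K p) h =
      1 / 2 * (if p \<in> D then h p + h (x, y) else h (fst p, y) + h (x, snd p))" for p
    by (simp add: K_def expectation_mix_pmf)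
  have set: "set_pmf (pair_pmf M N) = nbrs E x \<times> nbrs E y"
    using ne finite_nbrs by (simp add: M_def N_def)
  have pmf: "pmf (pair_pmf M N) p = 1 / (real (deg E x) * real (deg E y))" if "p \<in> nbrs E x \<times> nbrs E y" for p
    using that ne finite_nbrs by (cases p) (simp add: M_def N_def pmf_pair deg_def)
  have fin: "finite (set_pmf (bind_pmf (pair_pmf M N) K))"
    using finite_nbrs finK set by simp
  have "measure_pmf.expectation (bind_pmf (pair_pmf M N) K) h =
      (\<Sum>p\<in>nbrs E x \<times> nbrs E y. pmf (pair_pmf M N) p *\<^sub>R measure_pmf.expectation (K p) h)"
    using finK set finite_nbrs by (intro pmf_expectation_bind) auto
  also have "\<dots> = (\<Sum>p\<in>nbrs E x \<times> nbrs E y. 1 / (2 * (real (deg E x) * real (deg E y))) *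
      (if p \<in> D then h p + h (x, y) else h (fst p, y) + h (x, snd p)))"
    by (rule sum.cong) (auto simp: pmf EK)
  also have "\<dots> = 1 / (2 * (real (deg E x) * real (deg E y))) * (\<Sum>p\<in>nbrs E x \<times> nbrs E y.
      (if p \<in> D then h p + h (x, y) else h (fst p, y) + h (x, snd p)))"
    by (simp only: sum_distrib_left)
  finally have E: "measure_pmf.expectation (bind_pmf (pair_pmf M N) K) h = \<dots>" .
  have cancel: "2 * c * (1 / (2 * m) * S) = c / m * S" for c m S :: real by simp
  have "measure_pmf.expectation \<pi> h =
      (1 - \<alpha>) / (real (deg E x) * real (deg E y)) *
        (\<Sum>p\<in>nbrs E x \<times> nbrs E y. if p \<in> D then h p + h (x, y) else h (fst p, y) + h (x, snd p))
      + (2 * \<alpha> - 1) * h (x, y)"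
    unfolding \<pi>_def using \<epsilon> fin by (subst expectation_mix_pmf) (simp_all only: E cancel, simp_all)
  then show ?thesis using that 1 2 by (auto simp: couplings_def)
qed

end

section \<open>Bounds on the curvature of an edge\<close>

context weighted_graph begin

text \<open>Divided by \<open>d x y\<close>, this is the negated tree formula with distances in
  place of weights; by \<open>excess_ricci\<close> it is also a row of the Ricci matrix applied to
  the edge lengths.\<close>

definition excess :: "'a \<Rightarrow> 'a \<Rightarrow> real" where
  "excess x y = ((\<Sum>u\<in>nbrs E x. d x u) - 2 * d x y) / deg E x + ((\<Sum>v\<in>nbrs E y. d y v) - 2 * d x y) / deg E y"

abbreviation W :: "real \<Rightarrow> 'a \<Rightarrow> 'a \<Rightarrow> real" where
  "W \<alpha> x y \<equiv> wasserstein d (lazy_measure E \<alpha> x) (lazy_measure E \<alpha> y)"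

lemma W_le_coupling:
  assumes "{x, y} \<in> E" "\<pi> \<in> couplings (lazy_measure E \<alpha> x) (lazy_measure E \<alpha> y)"
  shows "W \<alpha> x y \<le> measure_pmf.expectation \<pi> (\<lambda>(u, v). d u v)"
proof (rule wasserstein_le[OF assms(2)])
  fix u v assume "u \<in> set_pmf (lazy_measure E \<alpha> x)" "v \<in> set_pmf (lazy_measure E \<alpha> y)"
  then show "d u v \<ge> 0"
    using lazy_measure_in_V nbrs_nonempty[OF assms(1)] edge_in_V[OF assms(1)] d_nonneg by blast
qed

lemma W_upper:
  assumes xy: "{x, y} \<in> E" and \<alpha>: "1 / 2 \<le> \<alpha>" "\<alpha> \<le> 1"
    and D: "D \<subseteq> (nbrs E x - {y}) \<times> (nbrs E y - {x})"
  shows "W \<alpha> x y \<le> d x y + (1 - \<alpha>) * (excess x y -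
    (\<Sum>(u, v)\<in>D. d x u + d x y + d y v - d u v) / (real (deg E x) * real (deg E y)))"
proof -
  \<comment> \<open>Here \<open>a u\<close> bounds the cost from \<open>u\<close> to
    \<open>y\<close> through \<open>x\<close>, and \<open>b v\<close> the cost from \<open>x\<close>
    to \<open>v\<close> through \<open>y\<close>. Nothing is paid when \<open>u = y\<close> or
    \<open>v = x\<close>, which produces the terms \<open>- 2 * d x y\<close> of
    \<open>excess\<close>. The value of \<delta> is what is saved by serving a pair of
    \<open>D\<close> directly and paying \<open>d x y\<close> for the freed mass.\<close>
  define a where "a u = (if u = y then 0 else d x u + d x y)" for u
  define b where "b v = (if v = x then 0 else d x y + d y v)" for v
  define \<delta> where "\<delta> = (\<lambda>(u, v). d x u + d x y + d y v - d u v)"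
  define h where "h = (\<lambda>(u, v). d u v)"
  define m where "m = real (deg E x) * real (deg E y)"
  let ?P = "nbrs E x \<times> nbrs E y"
  note V = edge_in_V[OF xy]
  have yx: "{y, x} \<in> E" using xy by (simp add: insert_commute)
  have dp: "real (deg E x) > 0" "real (deg E y) > 0" using deg_pos xy yx by auto
  have nV: "u \<in> V" if "u \<in> nbrs E z" for u z using that nbrs_subset by blast
  obtain \<pi> where \<pi>: "\<pi> \<in> couplings (lazy_measure E \<alpha> x) (lazy_measure E \<alpha> y)"
    "measure_pmf.expectation \<pi> h = (1 - \<alpha>) / m *
        (\<Sum>p\<in>?P. if p \<in> D then h p + h (x, y) else h (fst p, y) + h (x, snd p))
      + (2 * \<alpha> - 1) * h (x, y)"
    unfolding m_def by (rule lazy_coupling[OF xy \<alpha>])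
  have "(\<Sum>p\<in>?P. if p \<in> D then h p + h (x, y) else h (fst p, y) + h (x, snd p)) \<le>
      (\<Sum>p\<in>?P. a (fst p) + b (snd p) - (if p \<in> D then \<delta> p else 0))"
  proof (rule sum_mono)
    fix p assume p: "p \<in> ?P"
    obtain u v where uv: "p = (u, v)" by (cases p)
    have uv': "u \<in> V" "v \<in> V" using p uv nV by auto
    have "d u y \<le> a u" using V uv' d_triangle[of u x y] d_commute[of u x] by (auto simp: a_def)
    moreover have "d x v \<le> b v" using V uv' d_triangle[of x y v] by (auto simp: b_def)
    moreover have "p \<in> D \<Longrightarrow> u \<noteq> y \<and> v \<noteq> x" using D uv by auto
    ultimately show "(if p \<in> D then h p + h (x, y) else h (fst p, y) + h (x, snd p)) \<le>
        a (fst p) + b (snd p) - (if p \<in> D then \<delta> p else 0)"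
      by (auto simp: uv h_def \<delta>_def a_def b_def)
  qed
  also have "\<dots> = (\<Sum>p\<in>?P. a (fst p)) + (\<Sum>p\<in>?P. b (snd p)) - sum \<delta> D"
  proof -
    have "(\<Sum>p\<in>?P. if p \<in> D then \<delta> p else 0) = sum \<delta> (?P \<inter> D)"
      using finite_nbrs by (subst sum.inter_restrict) auto
    also have "?P \<inter> D = D" using D by auto
    finally show ?thesis by (simp add: sum.distrib sum_subtractf)
  qed
  also have "(\<Sum>p\<in>?P. a (fst p)) = deg E y * ((\<Sum>u\<in>nbrs E x. d x u) - 2 * d x y + deg E x * d x y)"
  proof -
    have "(\<Sum>p\<in>?P. a (fst p)) = (\<Sum>u\<in>nbrs E x. deg E y * a u)"
      unfolding deg_def by (simp add: sum.cartesian_product' sum.Sigma)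
    also have "\<dots> = deg E y * (\<Sum>u\<in>nbrs E x. a u)" by (simp add: sum_distrib_left)
    also have "(\<Sum>u\<in>nbrs E x. a u) = (\<Sum>u\<in>nbrs E x. d x u + d x y - (if u = y then 2 * d x y else 0))"
      by (rule sum.cong) (auto simp: a_def)
    also have "\<dots> = (\<Sum>u\<in>nbrs E x. d x u) - 2 * d x y + deg E x * d x y"
      using xy finite_nbrs by (simp add: sum.distrib sum_subtractf in_nbrs deg_def)
    finally show ?thesis .
  qed
  also have "(\<Sum>p\<in>?P. b (snd p)) = deg E x * ((\<Sum>v\<in>nbrs E y. d y v) - 2 * d x y + deg E y * d x y)"
  proof -
    have "(\<Sum>p\<in>?P. b (snd p)) = deg E x * (\<Sum>v\<in>nbrs E y. b v)"
      unfolding deg_def by (simp add: sum.cartesian_product' sum.Sigma)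
    also have "(\<Sum>v\<in>nbrs E y. b v) = (\<Sum>v\<in>nbrs E y. d x y + d y v - (if v = x then 2 * d x y else 0))"
      using d_commute[OF V] by (intro sum.cong) (auto simp: b_def)
    also have "\<dots> = (\<Sum>v\<in>nbrs E y. d y v) - 2 * d x y + deg E y * d x y"
      using yx finite_nbrs by (simp add: sum.distrib sum_subtractf in_nbrs deg_def)
    finally show ?thesis .
  qed
  finally have "(1 - \<alpha>) / m * (\<Sum>p\<in>?P. if p \<in> D then h p + h (x, y) else h (fst p, y) + h (x, snd p)) \<le>
      (1 - \<alpha>) / m *
      (deg E y * ((\<Sum>u\<in>nbrs E x. d x u) - 2 * d x y + deg E x * d x y) +
       deg E x * ((\<Sum>v\<in>nbrs E y. d y v) - 2 * d x y + deg E y * d x y) - sum \<delta> D)"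
    by (rule mult_left_mono) (use \<alpha> dp in \<open>simp add: m_def\<close>)
  then have "measure_pmf.expectation \<pi> h \<le> (1 - \<alpha>) / m *
      (deg E y * ((\<Sum>u\<in>nbrs E x. d x u) - 2 * d x y + deg E x * d x y) +
       deg E x * ((\<Sum>v\<in>nbrs E y. d y v) - 2 * d x y + deg E y * d x y) - sum \<delta> D) + (2 * \<alpha> - 1) * d x y"
    unfolding \<pi>(2) by (simp add: h_def)
  also have "\<dots> = d x y + (1 - \<alpha>) * (excess x y - sum \<delta> D / m)"
    unfolding excess_def m_def using dp by (simp add: field_simps)
  finally show ?thesis
    using W_le_coupling[OF xy \<pi>(1)] unfolding h_def \<delta>_def m_def by linarith
qed

lemma W_lower:
  assumes xy: "{x, y} \<in> E" and \<alpha>: "0 \<le> \<alpha>" "\<alpha> \<le> 1" and f: "edge_lipschitz E w f"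
  shows "\<alpha> * (f y - f x) +
    (1 - \<alpha>) * ((\<Sum>v\<in>nbrs E y. f v) / deg E y - (\<Sum>u\<in>nbrs E x. f u) / deg E x) \<le> W \<alpha> x y"
proof -
  note ne = nbrs_nonempty[OF xy] and V = edge_in_V[OF xy]
  have "measure_pmf.expectation (lazy_measure E \<alpha> y) f - measure_pmf.expectation (lazy_measure E \<alpha> x) f \<le> W \<alpha> x y"
    using lazy_measure_in_V ne V d_ge_lipschitz[OF f]
    by (intro wasserstein_dual finite_lazy_measure) blast+
  then show ?thesis using ne \<alpha> by (simp add: expectation_lazy_measure algebra_simps)
qed

lemma W_lazier:
  assumes xy: "{x, y} \<in> E" and "0 \<le> \<beta>" "\<beta> \<le> 1" "0 \<le> s" "s \<le> 1" "1 - \<alpha> = s * (1 - \<beta>)"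
  shows "W \<alpha> x y \<le> s * W \<beta> x y + (1 - s) * d x y"
proof -
  note ne = nbrs_nonempty[OF xy]
  have *: "W \<alpha> x y \<le> s * K + (1 - s) * d x y" 
    if \<pi>: "\<pi> \<in> couplings (lazy_measure E \<beta> x) (lazy_measure E \<beta> y)"
      and K: "K = measure_pmf.expectation \<pi> (\<lambda>(u, v). d u v)" for \<pi> K
  proof -
    have "mix_pmf s \<pi> (return_pmf (x, y)) \<in> couplings (lazy_measure E \<alpha> x) (lazy_measure E \<alpha> y)"
      using \<pi> lazy_measure_lazier[OF assms(2-6)] by (auto simp: couplings_def map_mix_pmf)
    from W_le_coupling[OF xy this] show ?thesis
      using assms(4,5) K finite_coupling[OF \<pi>] finite_lazy_measure[OF ne(1)] finite_lazy_measure[OF ne(2)]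
      by (simp add: expectation_mix_pmf)
  qed
  show ?thesis
  proof (cases "s = 0")
    case True
    obtain \<pi> where "\<pi> \<in> couplings (lazy_measure E \<beta> x) (lazy_measure E \<beta> y)"
      using couplings_nonempty by blast
    from *[OF this refl] True show ?thesis by simp
  next
    case False
    then have s: "s > 0" using assms(4) by simp
    \<comment> \<open>The diluted bound holds for every coupling and so passes to the infimum; the
      division by \<open>s\<close> is why \<open>s = 0\<close> is treated apart.\<close>
    have "(W \<alpha> x y - (1 - s) * d x y) / s \<le> W \<beta> x y"
      using * s by (intro wasserstein_ge) (simp add: field_simps)
    then show ?thesis using s by (simp add: field_simps)
  qed
qed

section \<open>Existence of the limit and two-sided bounds on the curvature\<close>

abbreviation K :: "'a \<Rightarrow> 'a \<Rightarrow> real \<Rightarrow> real" where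
  "K x y \<equiv> \<lambda>\<alpha>. lly_alpha_curvature E w \<alpha> x y / (1 - \<alpha>)"

lemma d_edge_pos: "{x, y} \<in> E \<Longrightarrow> d x y > 0"
  using d_pos edge_in_V edge_neq by metis

lemma lly_alpha_curvature_eq:
  "{x, y} \<in> E \<Longrightarrow> lly_alpha_curvature E w \<alpha> x y = (d x y - W \<alpha> x y) / d x y"
  using d_edge_pos[of x y] by (simp add: lly_alpha_curvature_def diff_divide_distrib)

text \<open>Diluting couplings with the point mass at \<open>(x, y)\<close> makes the quotient increasing in \<open>\<alpha>\<close>, whence
  the limit in the definition of the curvature exists.\<close>

lemma K_mono:
  assumes xy: "{x, y} \<in> E" and "0 \<le> \<beta>" "\<beta> \<le> \<alpha>" "\<alpha> < 1"
  shows "K x y \<beta> \<le> K x y \<alpha>"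
proof -
  define s where "s = (1 - \<alpha>) / (1 - \<beta>)"
  have s: "0 < s" "s \<le> 1" "1 - \<alpha> = s * (1 - \<beta>)" using assms by (auto simp: s_def)
  have "W \<alpha> x y \<le> s * W \<beta> x y + (1 - s) * d x y"
    using W_lazier[OF xy, of \<beta> s \<alpha>] s assms by simp
  then have "s * (d x y - W \<beta> x y) / d x y \<le> (d x y - W \<alpha> x y) / d x y"
    using d_edge_pos[OF xy] by (intro divide_right_mono) (auto simp: algebra_simps)
  then have "lly_alpha_curvature E w \<alpha> x y \<ge> s * lly_alpha_curvature E w \<beta> x y"
    by (simp add: lly_alpha_curvature_eq[OF xy])
  then have "s * lly_alpha_curvature E w \<beta> x y / (1 - \<alpha>) \<le> K x y \<alpha>"
    using assms by (intro divide_right_mono) auto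
  moreover have "s * lly_alpha_curvature E w \<beta> x y / (1 - \<alpha>) = K x y \<beta>"
    using s by simp
  ultimately show ?thesis by simp
qed

text \<open>The distance from \<open>x\<close> serves as the test function. All that matters about
  the bound is that it does not depend on \<alpha>, so that the increasing quotient
  converges.\<close>

lemma K_bounded:
  assumes xy: "{x, y} \<in> E" and "0 \<le> \<alpha>" "\<alpha> < 1"
  shows "K x y \<alpha> \<le> 1 + (\<Sum>u\<in>nbrs E x. d x u) / deg E x / d x y"
proof -
  note V = edge_in_V[OF xy]
  have "0 \<le> (\<Sum>v\<in>nbrs E y. d x v) / deg E y"
    using V nbrs_subset d_nonneg by (intro divide_nonneg_nonneg sum_nonneg) auto
  then have "(1 - \<alpha>) * (- (\<Sum>u\<in>nbrs E x. d x u) / deg E x) \<le>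
    (1 - \<alpha>) * ((\<Sum>v\<in>nbrs E y. d x v) / deg E y - (\<Sum>u\<in>nbrs E x. d x u) / deg E x)"
    using assms by (intro mult_left_mono) auto
  with W_lower[OF xy _ _ d_edge_lipschitz[OF V(1)], of \<alpha>] assms V
  have "\<alpha> * d x y - (1 - \<alpha>) * ((\<Sum>u\<in>nbrs E x. d x u) / deg E x) \<le> W \<alpha> x y" by simp
  then have "(d x y - W \<alpha> x y) / d x y \<le>
      (1 - \<alpha>) * (d x y + (\<Sum>u\<in>nbrs E x. d x u) / deg E x) / d x y"
    using d_edge_pos[OF xy] by (intro divide_right_mono) (auto simp: algebra_simps)
  then have "lly_alpha_curvature E w \<alpha> x y \<le> (1 - \<alpha>) * (1 + (\<Sum>u\<in>nbrs E x. d x u) / deg E x / d x y)"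
    using d_edge_pos[OF xy] unfolding lly_alpha_curvature_eq[OF xy] times_divide_eq_right[symmetric]
    by (simp add: add_divide_distrib)
  then show ?thesis using assms by (simp add: pos_divide_le_eq mult.commute)
qed

lemma lly_curvature_eqI: "(K x y \<longlongrightarrow> l) (at_left 1) \<Longrightarrow> lly_curvature E w x y = l"
  unfolding lly_curvature_def by (intro tendsto_Lim) auto

text \<open>\<open>Lim\<close> carries information only if the limit exists. A bounded increasing
  quotient converges to its supremum.\<close>

lemma K_tendsto:
  assumes xy: "{x, y} \<in> E"
  shows "(K x y \<longlongrightarrow> lly_curvature E w x y) (at_left 1)"
proof -
  define l where "l = (SUP \<alpha>\<in>{0..<1}. K x y \<alpha>)"
  have bdd: "bdd_above (K x y ` {0..<1})"
    using K_bounded[OF xy] by (auto intro!: bdd_aboveI)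
  have "(K x y \<longlongrightarrow> l) (at_left 1)"
  proof (rule increasing_tendsto)
    show "\<forall>\<^sub>F \<alpha> in at_left 1. K x y \<alpha> \<le> l"
      unfolding eventually_at_left_field l_def using bdd
      by (intro exI[of _ 0]) (auto intro!: cSUP_upper)
    fix z assume "z < l"
    then obtain \<beta> where \<beta>: "\<beta> \<in> {0..<1}" "z < K x y \<beta>"
      unfolding l_def using less_cSUP_iff[OF _ bdd] by auto
    then show "\<forall>\<^sub>F \<alpha> in at_left 1. z < K x y \<alpha>"
      unfolding eventually_at_left_field using K_mono[OF xy, of \<beta>]
      by (intro exI[of _ \<beta>]) (auto intro: less_le_trans)
  qed
  then show ?thesis using lly_curvature_eqI by blast
qed

text \<open>With \<open>D = {}\<close> this is the lower bound by the tree formula. A pair in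
  \<open>D\<close> improves it as soon as the detour through \<open>x\<close> and \<open>y\<close>
  is not a shortest path.\<close>

lemma lly_curvature_ge:
  assumes xy: "{x, y} \<in> E"
    and D: "D \<subseteq> (nbrs E x - {y}) \<times> (nbrs E y - {x})"
  shows "d x y * lly_curvature E w x y \<ge> - excess x y +
    (\<Sum>(u, v)\<in>D. d x u + d x y + d y v - d u v) / (real (deg E x) * real (deg E y))" (is "_ \<ge> ?c")
proof -
  have "?c / d x y \<le> lly_curvature E w x y"
  proof (rule tendsto_le[OF _ K_tendsto[OF xy] tendsto_const])
    show "\<forall>\<^sub>F \<alpha> in at_left 1. ?c / d x y \<le> K x y \<alpha>"
      unfolding eventually_at_left_field
    proof (intro exI[of _ "1/2"] conjI allI impI)
      fix \<alpha> :: real assume \<alpha>: "1 / 2 < \<alpha>" "\<alpha> < 1"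
      then have "W \<alpha> x y \<le> d x y - (1 - \<alpha>) * ?c"
        using W_upper[OF xy _ _ D, of \<alpha>] by (simp add: algebra_simps)
      then have "(1 - \<alpha>) * ?c / d x y \<le> lly_alpha_curvature E w \<alpha> x y"
        using d_edge_pos[OF xy] unfolding lly_alpha_curvature_eq[OF xy]
        by (intro divide_right_mono) linarith+
      then show "?c / d x y \<le> K x y \<alpha>"
        using \<alpha> by (simp add: pos_le_divide_eq mult.commute)
    qed simp
  qed simp
  then show ?thesis using d_edge_pos[OF xy] by (simp add: pos_divide_le_eq mult.commute)
qed

text \<open>Such an \<open>f\<close> turns every triangle inequality behind \<open>W_upper\<close>
  with \<open>D = {}\<close> into an equality, so that coupling is optimal.\<close>

lemma lly_curvature_le_potential:
  assumes xy: "{x, y} \<in> E" and f: "edge_lipschitz E w f" and fxy: "f y - f x = d x y"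
    and fx: "\<And>u. u \<in> nbrs E x - {y} \<Longrightarrow> f u = f x - d x u"
    and fy: "\<And>v. v \<in> nbrs E y - {x} \<Longrightarrow> f v = f y + d y v"
  shows "d x y * lly_curvature E w x y \<le> - excess x y"
proof -
  note V = edge_in_V[OF xy]
  have yx: "{y, x} \<in> E" using xy by (simp add: insert_commute)
  have dp: "real (deg E x) > 0" "real (deg E y) > 0" using deg_pos xy yx by auto
  \<comment> \<open>At the exceptional neighbour \<open>x\<close> the potential is
    \<open>f y - d x y\<close> instead of \<open>f y + d y x\<close>, hence the correction by
    \<open>2 * d x y\<close>.\<close>
  have "(\<Sum>v\<in>nbrs E y. f v) = (\<Sum>v\<in>nbrs E y. f y + d y v - (if v = x then 2 * d x y else 0))"
    using fy fxy d_commute[OF V] by (intro sum.cong) auto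
  also have "\<dots> = deg E y * f y + ((\<Sum>v\<in>nbrs E y. d y v) - 2 * d x y)"
    using yx finite_nbrs by (simp add: sum.distrib sum_subtractf in_nbrs deg_def)
  finally have 1: "(\<Sum>v\<in>nbrs E y. f v) / deg E y = f y + ((\<Sum>v\<in>nbrs E y. d y v) - 2 * d x y) / deg E y"
    using dp by (simp add: field_simps)
  have "(\<Sum>u\<in>nbrs E x. f u) = (\<Sum>u\<in>nbrs E x. f x - d x u + (if u = y then 2 * d x y else 0))"
    using fx fxy by (intro sum.cong) auto
  also have "\<dots> = deg E x * f x - ((\<Sum>u\<in>nbrs E x. d x u) - 2 * d x y)"
    using xy finite_nbrs by (simp add: sum.distrib sum_subtractf in_nbrs deg_def)
  finally have 2: "(\<Sum>u\<in>nbrs E x. f u) / deg E x = f x - ((\<Sum>u\<in>nbrs E x. d x u) - 2 * d x y) / deg E x"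
    using dp by (simp add: field_simps)
  have W: "d x y + (1 - \<alpha>) * excess x y \<le> W \<alpha> x y" if "0 \<le> \<alpha>" "\<alpha> \<le> 1" for \<alpha>
    using W_lower[OF xy that f] fxy unfolding 1 2 excess_def by (simp add: algebra_simps)
  have "lly_curvature E w x y \<le> - excess x y / d x y"
  proof (rule tendsto_le[OF _ tendsto_const K_tendsto[OF xy]])
    show "\<forall>\<^sub>F \<alpha> in at_left 1. K x y \<alpha> \<le> - excess x y / d x y"
      unfolding eventually_at_left_field
    proof (intro exI[of _ 0] conjI allI impI)
      fix \<alpha> :: real assume \<alpha>: "0 < \<alpha>" "\<alpha> < 1"
      then have "lly_alpha_curvature E w \<alpha> x y \<le> (1 - \<alpha>) * (- excess x y) / d x y"
        using d_edge_pos[OF xy] W[of \<alpha>] unfolding lly_alpha_curvature_eq[OF xy]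
        by (intro divide_right_mono) linarith+
      then show "K x y \<alpha> \<le> - excess x y / d x y"
        using \<alpha> by (simp add: pos_divide_le_eq mult.commute)
    qed simp
  qed simp
  then show ?thesis by (simp only: pos_le_divide_eq[OF d_edge_pos[OF xy]] mult.commute)
qed

end

section \<open>The Ricci matrix and the comparison of curvatures\<close>

context conn_graph begin

lemma edge_closed_eq_V:
  assumes closed: "\<And>a b. {a, b} \<in> E \<Longrightarrow> a \<in> X \<Longrightarrow> b \<in> X" and "r \<in> X" "r \<in> V"
  shows "V \<subseteq> X"
proof
  fix z assume "z \<in> V"
  then obtain p where p: "is_path E r p z" using conn assms(3) by (auto simp: connected_graph_def)
  have "successively (\<lambda>a b. {a, b} \<in> E) q \<Longrightarrow> q \<noteq> [] \<Longrightarrow> hd q \<in> X \<Longrightarrow> last q \<in> X" for q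
    by (induction q rule: induct_list012) (use closed in auto)
  then show "z \<in> X" using p assms(2) by (auto simp: is_path_def)
qed

lemma sum_incident_edges: "(\<Sum>e\<in>E. if z \<in> e then u e else 0) = strength E u z"
proof -
  have "(\<Sum>e\<in>E. if z \<in> e then u e else 0) = sum u {e \<in> E. z \<in> e}"
    using finite_E by (simp add: sum.inter_filter)
  also have "{e \<in> E. z \<in> e} = (\<lambda>y. {z, y}) ` nbrs E z"
  proof -
    have "e \<in> (\<lambda>y. {z, y}) ` nbrs E z" if "e \<in> E" "z \<in> e" for e
      proof -
      obtain a b where "e = {a, b}" "{a, b} \<in> E" using \<open>e \<in> E\<close> by (rule edgeE)
      then show ?thesis using that(2) by (auto simp: in_nbrs insert_commute)
    qed
    then show ?thesis by (auto simp: in_nbrs)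
  qed
  also have "sum u \<dots> = strength E u z"
    unfolding strength_def by (subst sum.reindex) (auto simp: inj_on_def doubleton_eq_iff)
  finally show ?thesis .
qed

text \<open>The edge itself is counted in both strengths with coefficient \<open>1 / deg\<close>,
  whereas the diagonal entry has the opposite sign; the difference accounts for the terms
  \<open>2 * u {x, y}\<close>. This links the tree formula to the eigenvalue equation.\<close>

lemma ricci_matrix_action:
  assumes xy: "{x, y} \<in> E"
  shows "(\<Sum>e\<in>E. ricci_matrix E {x, y} e * u e) =
    (strength E u x - 2 * u {x, y}) / deg E x + (strength E u y - 2 * u {x, y}) / deg E y"
proof -
  have ne: "x \<noteq> y" using edge_neq xy by blast
  define r where "r = (\<lambda>e. (if x \<in> e then u e else 0) / deg E x + (if y \<in> e then u e else 0) / deg E y)"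
  have "ricci_matrix E {x, y} e * u e = r e -
      (if e = {x, y} then 2 * u e / deg E x + 2 * u e / deg E y else 0)" for e
  proof -
    consider "x \<in> e" "y \<in> e" | "x \<in> e" "y \<notin> e" | "x \<notin> e" "y \<in> e" | "x \<notin> e" "y \<notin> e" by blast
    then have "(\<Sum>z\<in>{x, y} \<inter> e. 1 / deg E z) * u e = r e"
      by cases (use ne in \<open>simp_all add: r_def Int_insert_left distrib_right\<close>)
    moreover have "{x, y} = e \<Longrightarrow> r e = u e / deg E x + u e / deg E y" by (auto simp: r_def)
    ultimately show ?thesis using ne by (auto simp: ricci_matrix_def algebra_simps)
  qed
  then have "(\<Sum>e\<in>E. ricci_matrix E {x, y} e * u e) =
      (\<Sum>e\<in>E. r e) - (2 * u {x, y} / deg E x + 2 * u {x, y} / deg E y)"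
    using finite_E xy by (simp add: sum_subtractf)
  also have "(\<Sum>e\<in>E. r e) = strength E u x / deg E x + strength E u y / deg E y"
    unfolding r_def sum.distrib sum_divide_distrib[symmetric] sum_incident_edges ..
  finally show ?thesis by (simp add: diff_divide_distrib)
qed

text \<open>Pairing the inequality with \<open>u\<close> and using symmetry makes the weighted sum
  of the slacks vanish, so \<open>v\<close> is an eigenvector too. Subtracting from \<open>v\<close>
  the largest multiple of \<open>u\<close> that keeps it nonnegative leaves an eigenvector with a
  zero entry, and connectedness spreads this zero to all edges.\<close>

lemma perron_comparison:
  assumes E: "E \<noteq> {}" and u: "\<And>e. e \<in> E \<Longrightarrow> u e > 0" and v: "\<And>e. e \<in> E \<Longrightarrow> v e > 0"
    and eig: "\<And>e. e \<in> E \<Longrightarrow> (\<Sum>e'\<in>E. ricci_matrix E e e' * u e') = k * u e"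
    and ge: "\<And>e. e \<in> E \<Longrightarrow> (\<Sum>e'\<in>E. ricci_matrix E e e' * v e') \<ge> k * v e"
  shows "\<exists>c>0. \<forall>e\<in>E. v e = c * u e"
proof -
  let ?R = "ricci_matrix E"
  have sym: "?R e e' = ?R e' e" for e e' by (simp add: ricci_matrix_def Int_commute)
  have "(\<Sum>e\<in>E. u e * (\<Sum>e'\<in>E. ?R e e' * v e')) = (\<Sum>e\<in>E. \<Sum>e'\<in>E. u e * ?R e e' * v e')"
    by (simp add: sum_distrib_left mult.assoc)
  also have "\<dots> = (\<Sum>e'\<in>E. \<Sum>e\<in>E. u e * ?R e e' * v e')" by (rule sum.swap)
  also have "\<dots> = (\<Sum>e'\<in>E. v e' * (\<Sum>e\<in>E. ?R e' e * u e))"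
    by (simp add: sum_distrib_left sym mult_ac)
  also have "\<dots> = (\<Sum>e\<in>E. v e * (k * u e))" by (simp add: eig)
  also have "\<dots> = (\<Sum>e\<in>E. u e * (k * v e))" by (simp add: mult_ac)
  finally have "(\<Sum>e\<in>E. u e * ((\<Sum>e'\<in>E. ?R e e' * v e') - k * v e)) = 0"
    by (simp add: right_diff_distrib sum_subtractf)
  moreover have "u e * ((\<Sum>e'\<in>E. ?R e e' * v e') - k * v e) \<ge> 0" if "e \<in> E" for e
    using u[OF that] ge[OF that] by simp
  ultimately have "\<forall>e\<in>E. u e * ((\<Sum>e'\<in>E. ?R e e' * v e') - k * v e) = 0"
    using finite_E by (simp add: sum_nonneg_eq_0_iff)
  then have eq: "(\<Sum>e'\<in>E. ?R e e' * v e') = k * v e" if "e \<in> E" for e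
    using u[OF that] that by force
  define c where "c = Min ((\<lambda>e. v e / u e) ` E)"
  have "c \<in> (\<lambda>e. v e / u e) ` E" unfolding c_def using finite_E E by (intro Min_in) auto
  then obtain e0 where e0: "e0 \<in> E" "c = v e0 / u e0" by auto
  define y where "y e = v e - c * u e" for e
  have nonneg: "y e \<ge> 0" if "e \<in> E" for e
  proof -
    have "c \<le> v e / u e" unfolding c_def using finite_E that by simp
    then show ?thesis using u[OF that] by (simp add: y_def field_simps)
  qed
  have y0: "y e0 = 0" using e0 u[OF e0(1)] by (simp add: y_def)
  \<comment> \<open>In the row of a zero \<open>e\<close>, the diagonal term vanishes and the other
    terms are nonnegative with sum \<open>k * y e = 0\<close>. The entry at an adjacent edge has a
    positive coefficient, so it vanishes.\<close>
  have adj: "y e' = 0" if e: "e \<in> E" "y e = 0" and e': "e' \<in> E" "e \<inter> e' \<noteq> {}" for e e'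
  proof (cases "e = e'")
    case False
    have "(\<Sum>e'\<in>E. ?R e e' * y e') = k * y e"
      using eig[OF e(1)] eq[OF e(1)]
      by (simp add: y_def right_diff_distrib sum_subtractf mult.left_commute sum_distrib_left[symmetric])
    then have "(\<Sum>e'\<in>E. ?R e e' * y e') = 0" using e(2) by simp
    moreover have "?R e e' * y e' \<ge> 0" if "e' \<in> E" for e'
      using nonneg[OF that] e(2) by (cases "e = e'") (auto simp: ricci_matrix_def sum_nonneg)
    ultimately have "?R e e' * y e' = 0" using finite_E e'(1) by (simp add: sum_nonneg_eq_0_iff)
    moreover have "?R e e' > 0"
    proof -
      have fin: "finite (e \<inter> e')" using e(1) by (rule edgeE) auto
      have "1 / real (deg E z) > 0" if "z \<in> e \<inter> e'" for z
      proof -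
        obtain a b where ab: "e = {a, b}" "{a, b} \<in> E" using e(1) by (rule edgeE)
        then have "deg E a > 0" "deg E b > 0" using deg_pos[of a b] deg_pos[of b a] by (simp_all add: insert_commute)
        then show ?thesis using that ab(1) by auto
      qed
      then show ?thesis
        using False e'(2) fin sum_pos[of "e \<inter> e'" "\<lambda>z. 1 / real (deg E z)"] by (simp add: ricci_matrix_def)
    qed
    ultimately show ?thesis by simp
  qed (use e in simp)
  let ?X = "{z. \<exists>e\<in>E. y e = 0 \<and> z \<in> e}"
  obtain a b where ab: "e0 = {a, b}" "{a, b} \<in> E" using e0(1) by (rule edgeE)
  have "V \<subseteq> ?X"
  proof (rule edge_closed_eq_V)
    show "a \<in> ?X" "a \<in> V" using ab y0 edge_in_V by blast+
    fix s t assume st: "{s, t} \<in> E" "s \<in> ?X"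
    then have "y {s, t} = 0" using adj by blast
    then show "t \<in> ?X" using st(1) by blast
  qed
  have "y e = 0" if e: "e \<in> E" for e
  proof -
    obtain s t where "e = {s, t}" "{s, t} \<in> E" using e by (rule edgeE)
    then show ?thesis using \<open>V \<subseteq> ?X\<close> edge_in_V adj by blast
  qed
  moreover have "c > 0" using e0 u v by simp
  ultimately show ?thesis by (auto simp: y_def)
qed

end

section \<open>Edge lengths and the comparison of Einstein metrics\<close>

context weighted_graph begin

lemma lly_curvature_commute:
  assumes "{x, y} \<in> E" shows "lly_curvature E w x y = lly_curvature E w y x"
proof -
  note V = edge_in_V[OF assms] and ne = nbrs_nonempty[OF assms]
  have "W \<alpha> x y = W \<alpha> y x" for \<alpha>
  proof (rule wasserstein_commute)
    fix u z assume "u \<in> set_pmf (lazy_measure E \<alpha> x)" "z \<in> set_pmf (lazy_measure E \<alpha> y)"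
    then show "d u z = d z u" using lazy_measure_in_V ne V d_commute by blast
  qed
  then show ?thesis
    by (simp add: lly_curvature_def lly_alpha_curvature_def d_commute[OF V])
qed

text \<open>The distance between the end points; arbitrary on sets that are not edges.\<close>

definition edge_length :: "'a set \<Rightarrow> real" where
  "edge_length e = (SOME r. \<exists>x y. e = {x, y} \<and> r = d x y)"

lemma edge_length: assumes "{x, y} \<in> E" shows "edge_length {x, y} = d x y"
  unfolding edge_length_def
  using d_commute[OF edge_in_V[OF assms]] by (intro some_equality) (auto simp: doubleton_eq_iff)

lemma edge_length_pos: "e \<in> E \<Longrightarrow> edge_length e > 0"
  by (erule edgeE) (simp add: edge_length d_edge_pos)

lemma excess_ricci:
  assumes "{x, y} \<in> E"
  shows "excess x y = (\<Sum>e\<in>E. ricci_matrix E {x, y} e * edge_length e)"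
proof -
  have "strength E edge_length z = (\<Sum>u\<in>nbrs E z. d z u)" for z
    unfolding strength_def by (intro sum.cong) (auto simp: in_nbrs edge_length)
  then show ?thesis
    unfolding ricci_matrix_action[OF assms] excess_def by (simp add: edge_length assms)
qed

lemma obeys_tree_formula_iff:
  assumes xy: "{x, y} \<in> E" and geod: "\<And>a b. {a, b} \<in> E \<Longrightarrow> d a b = w {a, b}"
  shows "obeys_tree_formula E w x y \<longleftrightarrow> d x y * lly_curvature E w x y = - excess x y"
proof -
  have s: "strength E w z = (\<Sum>u\<in>nbrs E z. d z u)" for z
    unfolding strength_def by (intro sum.cong) (auto simp: in_nbrs geod)
  have T: "(strength E w x - 2 * w {x, y}) / (w {x, y} * deg E x)
        + (strength E w y - 2 * w {x, y}) / (w {x, y} * deg E y) = excess x y / d x y"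
    unfolding s excess_def using geod[OF xy] by (simp add: add_divide_distrib mult.commute)
  then show ?thesis
    unfolding obeys_tree_formula_def T using d_edge_pos[OF xy] by (auto simp: field_simps)
qed

text \<open>The weights are not assumed geodesic, so the comparison concerns edge lengths only: the
  bound with \<open>D = {}\<close> says that they satisfy the eigenvalue equation with an
  inequality.\<close>

lemma einstein_edge_length:
  assumes "discrete_einstein E w (- k)" and E: "E \<noteq> {}" and u: "\<And>e. e \<in> E \<Longrightarrow> u e > 0"
    and eig: "\<And>e. e \<in> E \<Longrightarrow> (\<Sum>e'\<in>E. ricci_matrix E e e' * u e') = k * u e"
  shows "\<exists>c>0. \<forall>e\<in>E. edge_length e = c * u e"
proof (rule perron_comparison[OF E u edge_length_pos eig])
  fix e assume "e \<in> E"
  then obtain x y where xy: "e = {x, y}" "{x, y} \<in> E" by (metis edgeE)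
  have "lly_curvature E w x y = - k" using assms(1) xy by (auto simp: discrete_einstein_def)
  then show "k * edge_length e \<le> (\<Sum>e'\<in>E. ricci_matrix E e e' * edge_length e')"
    using lly_curvature_ge[OF xy(2), of "{}"] xy by (simp add: edge_length excess_ricci mult.commute)
qed

end

text \<open>The comparison on edges extends to all pairs, since \<open>w.d a\<close> divided by
  \<open>t\<close> is Lipschitz for \<open>w'\<close>. Every coupling then costs at most
  \<open>t\<close> times as much under \<open>w\<close> as under \<open>w'\<close>, while the
  normalising distance of \<open>x\<close> and \<open>y\<close> scales by exactly
  \<open>t\<close>.\<close>

lemma lly_curvature_mono:
  assumes "weighted_graph V E w" "weighted_graph V E w'" and t: "t > 0"
    and le: "\<And>a b. {a, b} \<in> E \<Longrightarrow> graph_dist E w a b \<le> t * graph_dist E w' a b"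
    and xy: "{x, y} \<in> E" and eq: "graph_dist E w x y = t * graph_dist E w' x y"
  shows "lly_curvature E w' x y \<le> lly_curvature E w x y"
proof -
  interpret w: weighted_graph V E w by fact
  interpret w': weighted_graph V E w' by fact
  have d: "w.d a b \<le> t * w'.d a b" if ab: "a \<in> V" "b \<in> V" for a b
  proof -
    have "edge_lipschitz E w' (\<lambda>z. w.d a z / t)"
      unfolding edge_lipschitz_def
    proof (intro allI impI)
      fix b c assume bc: "{b, c} \<in> E"
      have "w.d a c - w.d a b \<le> w.d b c"
        using w.d_triangle[of a b c] ab w.edge_in_V[OF bc] by simp
      also have "\<dots> \<le> t * w' {b, c}"
        using le[OF bc] w'.d_le_edge[OF bc] t by (meson less_imp_le mult_left_mono order_trans)
      finally show "w.d a c / t - w.d a b / t \<le> w' {b, c}"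
        using t by (simp add: diff_divide_distrib[symmetric] pos_divide_le_eq mult.commute)
    qed
    from w'.d_ge_lipschitz[OF this ab] show ?thesis
      using ab t by (simp add: pos_divide_le_eq mult.commute)
  qed
  have W: "w.W \<alpha> x y / t \<le> w'.W \<alpha> x y" for \<alpha>
  proof (rule wasserstein_ge)
    fix \<pi> assume \<pi>: "\<pi> \<in> couplings (lazy_measure E \<alpha> x) (lazy_measure E \<alpha> y)"
    note ne = w.nbrs_nonempty[OF xy]
    have fin: "finite (set_pmf \<pi>)"
      using finite_coupling[OF \<pi>] w.finite_lazy_measure ne by blast
    have "w.W \<alpha> x y \<le> measure_pmf.expectation \<pi> (\<lambda>(u, v). w.d u v)"
      by (rule w.W_le_coupling[OF xy \<pi>])
    also have "\<dots> \<le> measure_pmf.expectation \<pi> (\<lambda>p. t * (case p of (u, v) \<Rightarrow> w'.d u v))"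
      using fin set_coupling[OF \<pi>] d w.lazy_measure_in_V ne w.edge_in_V[OF xy]
      by (intro integral_mono_AE integrable_measure_pmf_finite) (auto simp: AE_measure_pmf_iff, blast)
    finally show "w.W \<alpha> x y / t \<le> measure_pmf.expectation \<pi> (\<lambda>(u, v). w'.d u v)"
      using t by (simp add: pos_divide_le_eq mult.commute)
  qed
  show ?thesis
  proof (rule tendsto_le[OF _ w.K_tendsto[OF xy] w'.K_tendsto[OF xy]])
    show "\<forall>\<^sub>F \<alpha> in at_left 1. w'.K x y \<alpha> \<le> w.K x y \<alpha>"
      unfolding eventually_at_left_field
    proof (intro exI[of _ 0] conjI allI impI divide_right_mono)
      fix \<alpha> :: real assume "0 < \<alpha>" "\<alpha> < 1"
      have "w.W \<alpha> x y / w.d x y \<le> w'.W \<alpha> x y / w'.d x y"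
        using divide_right_mono[OF W, of "w'.d x y"] w'.d_edge_pos[OF xy] by (simp add: eq)
      then show "lly_alpha_curvature E w' \<alpha> x y \<le> lly_alpha_curvature E w \<alpha> x y"
        by (simp add: lly_alpha_curvature_def)
    qed auto
  qed simp
qed

text \<open>An edge where the ratio of the two lengths is maximal meets the hypotheses of
  \<open>lly_curvature_mono\<close>. Exchanging the weightings gives equality of the
  curvatures.\<close>

lemma einstein_curvature_le:
  assumes "weighted_graph V E w" "weighted_graph V E w'" "E \<noteq> {}"
    and "discrete_einstein E w k" "discrete_einstein E w' k'"
  shows "k' \<le> k"
proof -
  interpret w: weighted_graph V E w by fact
  interpret w': weighted_graph V E w' by fact
  let ?r = "\<lambda>e. w.edge_length e / w'.edge_length e"
  define t where "t = Max (?r ` E)"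
  have "t \<in> ?r ` E" unfolding t_def using w.finite_E assms(3) by (intro Max_in) auto
  then obtain e where e: "e \<in> E" "t = ?r e" by auto
  then obtain x y where xy: "e = {x, y}" "{x, y} \<in> E" by (metis w.edgeE)
  have t: "t > 0" using e w.edge_length_pos w'.edge_length_pos by simp
  have "lly_curvature E w' x y \<le> lly_curvature E w x y"
  proof (rule lly_curvature_mono[OF assms(1,2) t _ xy(2)])
    show "w.d x y = t * w'.d x y"
      using e(2) xy w'.d_edge_pos[OF xy(2)] by (simp add: w.edge_length w'.edge_length)
    fix a b assume ab: "{a, b} \<in> E"
    then have "?r {a, b} \<le> t" unfolding t_def using w.finite_E by simp
    then show "w.d a b \<le> t * w'.d a b"
      using w'.d_edge_pos[OF ab] ab by (simp add: w.edge_length w'.edge_length pos_divide_le_eq)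
  qed
  then show ?thesis using assms(4,5) xy(2) by (simp add: discrete_einstein_def)
qed

section \<open>Unicyclic graphs\<close>

text \<open>Reachability by walks from a set of roots. Walks may repeat vertices, which makes the
  deletion of edges easy to handle, and several roots are needed for counting.\<close>

definition reach :: "'a set set \<Rightarrow> 'a set \<Rightarrow> 'a set" where
  "reach F R = {(a, b). {a, b} \<in> F}\<^sup>* `` R"

lemma reach_base: "R \<subseteq> reach F R"
  by (auto simp: reach_def)

lemma reach_edge: "{a, b} \<in> F \<Longrightarrow> a \<in> reach F R \<Longrightarrow> b \<in> reach F R"
  unfolding reach_def by (auto intro: rtrancl_into_rtrancl)

lemma reach_least:
  assumes "R \<subseteq> X" and closed: "\<And>a b. {a, b} \<in> F \<Longrightarrow> a \<in> X \<Longrightarrow> b \<in> X"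
  shows "reach F R \<subseteq> X"
proof -
  have "(a, b) \<in> {(a, b). {a, b} \<in> F}\<^sup>* \<Longrightarrow> a \<in> X \<Longrightarrow> b \<in> X" for a b
    by (induction rule: rtrancl_induct) (use closed in auto)
  then show ?thesis using assms(1) by (auto simp: reach_def)
qed

lemma reach_trans: "b \<in> reach F {a} \<Longrightarrow> a \<in> reach F R \<Longrightarrow> b \<in> reach F R"
  using reach_least[of "{a}" "reach F R" F] reach_edge[of _ _ F R] by blast

lemma reach_sym: assumes "b \<in> reach F {a}" shows "a \<in> reach F {b}"
proof -
  have "reach F {a} \<subseteq> {z. a \<in> reach F {z}}"
  proof (rule reach_least)
    show "{a} \<subseteq> {z. a \<in> reach F {z}}" using reach_base[of "{a}" F] by simp
    fix s t assume st: "{s, t} \<in> F" "s \<in> {z. a \<in> reach F {z}}"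
    have "s \<in> reach F {t}"
      using reach_edge[of t s F "{t}"] reach_base[of "{t}" F] st(1) by (simp add: insert_commute)
    then show "t \<in> {z. a \<in> reach F {z}}" using st(2) reach_trans by simp
  qed
  then show ?thesis using assms by blast
qed

lemma reach_remove_root:
  assumes "r \<in> reach F (R - {r})" shows "reach F R \<subseteq> reach F (R - {r})"
proof (rule reach_least)
  show "R \<subseteq> reach F (R - {r})" using assms reach_base[of "R - {r}" F] by blast
qed (rule reach_edge)

lemma reach_mono: "F \<subseteq> F' \<Longrightarrow> reach F R \<subseteq> reach F' R"
  by (rule reach_least[OF reach_base]) (auto intro: reach_edge)

text \<open>Each edge attaches at most one new vertex. In the induction an added edge is traded for
  an added root, which raises the bound by the same amount.\<close>

lemma card_reach_le:
  assumes "finite F" "finite R"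
  shows "finite (reach F R) \<and> card (reach F R) \<le> card F + card R"
  using assms
proof (induction F arbitrary: R rule: finite_induct)
  case empty
  have "reach {} R \<subseteq> R" by (rule reach_least) auto
  then show ?case using empty by (simp add: card_mono finite_subset)
next
  case (insert e F)
  have base: "finite (reach (insert e F) R) \<and> card (reach (insert e F) R) \<le> card (insert e F) + card R"
    if "reach (insert e F) R \<subseteq> reach F (insert z R)" for z
  proof -
    have IH: "finite (reach F (insert z R))" "card (reach F (insert z R)) \<le> card F + card (insert z R)"
      using insert.IH[of "insert z R"] insert.prems by auto
    moreover have "card (insert z R) \<le> Suc (card R)" by (rule card_insert_le_m1) auto
    ultimately show ?thesis
      using card_mono[OF IH(1) that] finite_subset[OF that IH(1)] insert.hyps by simp
  qed
  show ?case
  proof (cases "\<exists>a b. e = {a, b} \<and> a \<in> reach F R")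
    case True
    then obtain a b where ab: "e = {a, b}" "a \<in> reach F R" by blast
    have base': "insert b R \<subseteq> reach F (insert b R)" by (rule reach_base)
    have "reach F R \<subseteq> reach F (insert b R)"
    proof (rule reach_least)
      show "R \<subseteq> reach F (insert b R)" using base' by blast
    qed (rule reach_edge)
    then have mem: "a \<in> reach F (insert b R)" "b \<in> reach F (insert b R)"
      using ab(2) base' by blast+
    have "reach (insert e F) R \<subseteq> reach F (insert b R)"
    proof (rule reach_least)
      show "R \<subseteq> reach F (insert b R)" using base' by blast
      fix s t assume st: "{s, t} \<in> insert e F" "s \<in> reach F (insert b R)"
      show "t \<in> reach F (insert b R)"
      proof (cases "{s, t} = e")
        case True
        then have "t = a \<or> t = b" using ab(1) by (auto simp: doubleton_eq_iff)
        then show ?thesis using mem by blast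
      next
        case False
        then have "{s, t} \<in> F" using st(1) by blast
        then show ?thesis using st(2) by (rule reach_edge)
      qed
    qed
    then show ?thesis by (rule base)
  next
    \<comment> \<open>An edge with no reached end cannot be the first new edge of a walk from the
      roots.\<close>
    case False
    have sub: "reach (insert e F) R \<subseteq> reach F R"
    proof (rule reach_least[OF reach_base])
      fix s t assume st: "{s, t} \<in> insert e F" "s \<in> reach F R"
      then have "{s, t} \<in> F" using False by blast
      then show "t \<in> reach F R" using st(2) by (rule reach_edge)
    qed
    have IH: "finite (reach F R)" "card (reach F R) \<le> card F + card R"
      using insert.IH[of R] insert.prems by auto
    then show ?thesis
      using card_mono[OF IH(1) sub] finite_subset[OF sub IH(1)] insert.hyps by simp
  qed
qed

text \<open>Any use of the deleted edge can be replaced by a detour between its ends.\<close>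

lemma reach_remove_edge:
  assumes "b \<in> reach (F - {{a, b}}) {a}"
  shows "reach F R \<subseteq> reach (F - {{a, b}}) R"
proof (rule reach_least[OF reach_base])
  fix s t assume st: "{s, t} \<in> F" "s \<in> reach (F - {{a, b}}) R"
  show "t \<in> reach (F - {{a, b}}) R"
  proof (cases "{s, t} = {a, b}")
    case True
    then have "t \<in> reach (F - {{a, b}}) {s}"
      using assms reach_sym[OF assms] by (auto simp: doubleton_eq_iff)
    then show ?thesis using st(2) by (rule reach_trans)
  next
    case False
    then have "{s, t} \<in> F - {{a, b}}" using st(1) by blast
    then show ?thesis using st(2) by (rule reach_edge)
  qed
qed

lemma (in conn_graph) reach_eq_V: "r \<in> V \<Longrightarrow> V \<subseteq> reach E {r}"
  using reach_base[of "{r}" E] by (intro edge_closed_eq_V[of _ r]) (auto intro: reach_edge)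

section \<open>Cyclic indexing, bridges and the trees attached to the cycle\<close>

locale unicyclic_graph = conn_graph +
  fixes C :: "'a list"
  assumes card_edges: "card E = card V" and cycle: "is_cycle E C"
begin

abbreviation g :: nat where "g \<equiv> length C"
abbreviation v :: "int \<Rightarrow> 'a" where "v \<equiv> cyc_vertex C"
abbreviation c :: "int \<Rightarrow> 'a set" where "c \<equiv> cyc_edge C"

lemma g_ge_3: "g \<ge> 3" using cycle by (simp add: is_cycle_def)

lemma C_nonempty [simp]: "C \<noteq> []" using g_ge_3 by auto

lemma v_eq_iff: "v i = v j \<longleftrightarrow> int g dvd i - j"
proof -
  have "v i = v j \<longleftrightarrow> nat (i mod int g) = nat (j mod int g)"
    unfolding cyc_vertex_def using cycle
    by (intro nth_eq_iff_index_eq) (auto simp: is_cycle_def nat_less_iff)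
  also have "\<dots> \<longleftrightarrow> i mod int g = j mod int g"
    using g_ge_3 by (subst nat_eq_iff2) auto
  finally show ?thesis by (simp add: mod_eq_dvd_iff)
qed

lemma v_add_g: "v (i + int g) = v i" "v (i - int g) = v i"
  by (simp_all add: v_eq_iff)

lemma v_neq: "0 < \<bar>i - j\<bar> \<Longrightarrow> \<bar>i - j\<bar> < int g \<Longrightarrow> v i \<noteq> v j"
  using zdvd_not_zless[of "\<bar>i - j\<bar>" "int g"] by (auto simp: v_eq_iff)

lemma c_eq: "c j = {v (j - 1), v j}"
  by (simp add: cyc_edge_def)

lemma c_add_g: "c (i + int g) = c i" "c (i - int g) = c i"
proof -
  have "c (i + int g) = c i" for i
    using v_add_g(1)[of i] v_add_g(1)[of "i - 1"] by (simp add: c_eq algebra_simps)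
  from this[of i] this[of "i - int g"] show "c (i + int g) = c i" "c (i - int g) = c i" by auto
qed

lemma c_eqI: "int g dvd i - j \<Longrightarrow> c i = c j"
  unfolding c_eq using v_eq_iff[of i j] v_eq_iff[of "i - 1" "j - 1"] by simp

lemma c_eq_iff: "c i = c j \<longleftrightarrow> int g dvd i - j"
proof
  assume "c i = c j"
  then consider "v i = v j" | "v i = v (j - 1)" "v (i - 1) = v j"
    by (auto simp: c_eq doubleton_eq_iff)
  then show "int g dvd i - j"
  proof cases
    \<comment> \<open>If the edges agreed with reversed orientation, the length of the cycle would
      divide 2.\<close>
    case 2
    then have "int g dvd i - (j - 1)" "int g dvd (i - 1) - j" by (simp_all only: v_eq_iff)
    then have "int g dvd (i - (j - 1)) - ((i - 1) - j)" by (rule dvd_diff)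
    then have "int g dvd 2" by simp
    then show ?thesis using g_ge_3 zdvd_imp_le[of "int g" 2] by simp
  qed (simp add: v_eq_iff)
qed (rule c_eqI)

lemma index_shift:
  obtains k where "k < g" "int g dvd i - (j + int k)"
proof -
  have "nat ((i - j) mod int g) < g" by (simp add: nat_less_iff)
  moreover have "int g dvd i - (j + int (nat ((i - j) mod int g)))"
    by (simp add: mod_eq_dvd_iff[symmetric] mod_simps)
  ultimately show ?thesis by (rule that)
qed

lemma c_shift: "\<exists>k<g. c i = c (j + int k)"
  using index_shift c_eqI by metis

lemma v_shift: "\<exists>k<g. v i = v (j + int k)"
  using index_shift v_eq_iff by metis

lemma range_c: "range c = c ` {1..int g}"
proof -
  have "c i \<in> c ` {1..int g}" for i
  proof -
    obtain k where "k < g" "c i = c (1 + int k)" using c_shift by blast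
    then show ?thesis by auto
  qed
  then show ?thesis by auto
qed

lemma c_in_E: "c i \<in> E"
proof -
  have "c i \<in> c ` {1..int g}" using range_c by blast
  then show ?thesis using cycle by (auto simp: is_cycle_def)
qed

lemma range_c_subset: "range c \<subseteq> E"
  using c_in_E by blast

lemma v_in_V: "v i \<in> V"
  using c_in_E[of i] edge_in_V by (auto simp: c_eq)

lemma card_range_c: "card (range c) = g"
proof -
  have "inj_on c {1..int g}"
  proof (rule inj_onI)
    fix i j assume "i \<in> {1..int g}" "j \<in> {1..int g}" "c i = c j"
    then have "int g dvd \<bar>i - j\<bar>" "\<bar>i - j\<bar> < int g" by (auto simp: c_eq_iff)
    then show "i = j" using zdvd_not_zless[of "\<bar>i - j\<bar>" "int g"] by fastforce
  qed
  then show ?thesis by (simp add: range_c card_image)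
qed

lemma cycle_nbr:
  assumes "{v i, u} \<in> range c"
  shows "u = v (i - 1) \<or> u = v (i + 1)"
proof -
  obtain k where "{v i, u} = {v (k - 1), v k}" using assms by (auto simp: c_eq)
  then consider "v i = v (k - 1)" "u = v k" | "v i = v k" "u = v (k - 1)"
    by (auto simp: doubleton_eq_iff)
  then show ?thesis
  proof cases
    case 1
    then have "v k = v (i + 1)" using v_eq_iff[of "k - 1" i] v_eq_iff[of k "i + 1"] by (simp add: algebra_simps)
    then show ?thesis using 1 by simp
  next
    case 2
    then have "v (k - 1) = v (i - 1)" using v_eq_iff[of k i] v_eq_iff[of "k - 1" "i - 1"] by simp
    then show ?thesis using 2 by simp
  qed
qed

lemma cycle_reach: "k < g \<Longrightarrow> v (j + int k) \<in> reach (range c - {c j}) {v j}"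
proof (induction k)
  case 0
  then show ?case using reach_base[of "{v j}"] by simp
next
  case (Suc k)
  have "\<not> int g dvd int (Suc k)"
    using Suc.prems by (metis int_dvd_int_iff nat_dvd_not_less zero_less_Suc)
  then have "c (j + int (Suc k)) \<noteq> c j" by (simp add: c_eq_iff del: of_nat_Suc)
  moreover have "c (j + int (Suc k)) = {v (j + int k), v (j + int (Suc k))}"
    unfolding c_eq by (simp add: algebra_simps)
  ultimately have "{v (j + int k), v (j + int (Suc k))} \<in> range c - {c j}" by (metis DiffI rangeI singletonD)
  moreover have "v (j + int k) \<in> reach (range c - {c j}) {v j}" using Suc by simp
  ultimately show ?case by (rule reach_edge)
qed

lemma v_prev: "v (j - 1) = v (j + int (g - 1))"
proof -
  have "j + int (g - 1) = (j - 1) + int g" using g_ge_3 by simp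
  then show ?thesis using v_add_g(1)[of "j - 1"] by (simp only:)
qed

text \<open>The detour runs along the remaining cycle edges. The set \<open>F\<close> is left
  general because another edge will have been deleted already.\<close>

lemma cycle_edge_not_bridge:
  assumes "range c \<subseteq> F" shows "v j \<in> reach (F - {c j}) {v (j - 1)}"
proof -
  have "v (j - 1) \<in> reach (range c - {c j}) {v j}"
    unfolding v_prev using g_ge_3 by (intro cycle_reach) simp
  also have "\<dots> \<subseteq> reach (F - {c j}) {v j}" using assms by (intro reach_mono) auto
  finally show ?thesis by (rule reach_sym)
qed

text \<open>Otherwise removing this edge and a cycle edge would leave \<open>V\<close> connected by \<open>card V - 2\<close> edges.\<close>

lemma pendant_edge_bridge:
  assumes xy: "{x, y} \<in> E - range c"
  shows "x \<notin> reach (E - {{x, y}}) {y}"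
proof
  assume "x \<in> reach (E - {{x, y}}) {y}"
  then have "y \<in> reach (E - {{x, y}}) {x}" by (rule reach_sym)
  then have "reach E {x} \<subseteq> reach (E - {{x, y}}) {x}" by (rule reach_remove_edge)
  also have "\<dots> \<subseteq> reach (E - {{x, y}} - {c 0}) {x}"
    unfolding c_eq[of 0]
  proof (rule reach_remove_edge)
    have "range c \<subseteq> E - {{x, y}}" using xy range_c_subset by blast
    from cycle_edge_not_bridge[OF this, of 0] show "v 0 \<in> reach (E - {{x, y}} - {{v (0 - 1), v 0}}) {v (0 - 1)}"
      unfolding c_eq[of 0] .
  qed
  finally have sub: "V \<subseteq> reach (E - {{x, y}} - {c 0}) {x}"
    using reach_eq_V[of x] xy edge_in_V(1)[of x y] by blast
  have "{x, y} \<noteq> c 0" using xy by blast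
  then have "card (E - {{x, y}} - {c 0}) = card E - 2"
    using finite_E xy c_in_E by (simp add: card_Diff_singleton)
  moreover have "card V \<le> card (E - {{x, y}} - {c 0}) + 1"
    using card_reach_le[of "E - {{x, y}} - {c 0}" "{x}"] finite_E card_mono[OF _ sub] by simp
  moreover have "card E \<ge> 3"
    using card_mono[OF finite_E range_c_subset] card_range_c g_ge_3 by simp
  ultimately show False using card_edges by simp
qed

text \<open>The \<open>card V - g\<close> edges outside the cycle join every vertex to one of the \<open>g\<close> cycle vertices,
  and by counting they would be too few if they joined two cycle vertices.\<close>

lemma cycle_projection:
  obtains p :: "'a \<Rightarrow> nat" where
    "\<And>z. z \<in> V \<Longrightarrow> p z < g"
    "\<And>k. k < g \<Longrightarrow> p (v (j + int k)) = k"
    "\<And>a b. {a, b} \<in> E - range c \<Longrightarrow> p a = p b"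
proof -
  let ?F = "E - range c" and ?S = "(\<lambda>k. v (j + int k)) ` {..<g}"
  have inj: "inj_on (\<lambda>k. v (j + int k)) {..<g}"
  proof (rule inj_onI, rule ccontr)
    fix k l assume "k \<in> {..<g}" "l \<in> {..<g}" "v (j + int k) = v (j + int l)" "k \<noteq> l"
    then show False using v_neq[of "j + int k" "j + int l"] by auto
  qed
  have cS: "a \<in> ?S" if "a \<in> c i" for a i
  proof -
    have "a = v (i - 1) \<or> a = v i" using that by (auto simp: c_eq)
    then obtain k where "k < g" "a = v (j + int k)" using v_shift by metis
    then show ?thesis by blast
  qed
  have cover: "V \<subseteq> reach ?F ?S"
  proof (rule edge_closed_eq_V)
    show "v j \<in> reach ?F ?S" using reach_base[of ?S ?F] cS[of "v j" j] by (auto simp: c_eq)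
    show "v j \<in> V" by (rule v_in_V)
    fix a b assume ab: "{a, b} \<in> E" "a \<in> reach ?F ?S"
    show "b \<in> reach ?F ?S"
    proof (cases "{a, b} \<in> range c")
      case True
      then obtain i where "{a, b} = c i" by (elim rangeE)
      then have "b \<in> c i" by blast
      from cS[OF this] show ?thesis by (rule subsetD[OF reach_base])
    next
      case False
      then have "{a, b} \<in> ?F" using ab(1) by blast
      then show ?thesis using ab(2) by (rule reach_edge)
    qed
  qed
  \<comment> \<open>If two cycle vertices were joined outside the cycle, one of them could be
    dropped as a root: then \<open>g - 1\<close> roots and \<open>card E - g\<close> edges would
    reach all of \<open>V\<close>, contradicting \<open>card E = card V\<close>.\<close>
  have uniq: "k = l" if kl: "k < g" "l < g" "z \<in> reach ?F {v (j + int k)}" "z \<in> reach ?F {v (j + int l)}" for k l z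
  proof (rule ccontr)
    assume "k \<noteq> l"
    let ?T = "?S - {v (j + int l)}"
    have "v (j + int k) \<noteq> v (j + int l)" using v_neq[of "j + int k" "j + int l"] kl \<open>k \<noteq> l\<close> by auto
    then have T: "v (j + int k) \<in> ?T" using kl(1) by blast
    have "v (j + int l) \<in> reach ?F {v (j + int k)}"
      by (rule reach_trans[OF reach_sym[OF kl(4)] kl(3)])
    from reach_trans[OF this subsetD[OF reach_base T]] have "reach ?F ?S \<subseteq> reach ?F ?T"
      by (rule reach_remove_root)
    with cover have "V \<subseteq> reach ?F ?T" by (rule subset_trans)
    then have "card V \<le> card ?F + card ?T"
      using card_reach_le[of ?F ?T] finite_E card_mono[of "reach ?F ?T" V] by simp
    also have "card ?F = card E - g"
      using card_Diff_subset[of "range c" E] range_c_subset finite_subset[OF _ finite_E] card_range_c by simp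
    also have "card ?T = g - 1"
      using kl inj by (simp add: card_Diff_singleton card_image)
    also have "card E - g + (g - 1) < card E"
      using card_mono[OF finite_E range_c_subset] card_range_c g_ge_3 by simp
    finally show False using card_edges by simp
  qed
  define p where "p z = (THE k. k < g \<and> z \<in> reach ?F {v (j + int k)})" for z
  have pI: "p z = k" if "k < g" "z \<in> reach ?F {v (j + int k)}" for z k
    unfolding p_def
  proof (rule the_equality)
    show "l = k" if "l < g \<and> z \<in> reach ?F {v (j + int l)}" for l
      using that uniq \<open>k < g\<close> \<open>z \<in> reach ?F {v (j + int k)}\<close> by metis
  qed (use that in simp)
  have ex: "\<exists>k<g. z \<in> reach ?F {v (j + int k)}" if "z \<in> V" for z
  proof -
    have "reach ?F ?S \<subseteq> {z. \<exists>k<g. z \<in> reach ?F {v (j + int k)}}"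
    proof (rule reach_least)
      show "?S \<subseteq> {z. \<exists>k<g. z \<in> reach ?F {v (j + int k)}}"
      proof
        fix a assume "a \<in> ?S"
        then obtain k where k: "k < g" "a = v (j + int k)" by auto
        then have "a \<in> reach ?F {v (j + int k)}" using reach_base[of "{a}" ?F] by simp
        with k(1) show "a \<in> {z. \<exists>k<g. z \<in> reach ?F {v (j + int k)}}" by (intro CollectI exI conjI)
      qed
      fix a b assume ab: "{a, b} \<in> ?F" "a \<in> {z. \<exists>k<g. z \<in> reach ?F {v (j + int k)}}"
      then show "b \<in> {z. \<exists>k<g. z \<in> reach ?F {v (j + int k)}}" using reach_edge[OF ab(1)] by fast
    qed
    with cover have "V \<subseteq> {z. \<exists>k<g. z \<in> reach ?F {v (j + int k)}}" by (rule subset_trans)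
    with that show ?thesis by (rule subsetD[THEN CollectD, rotated])
  qed
  show ?thesis
  proof
    show "p z < g" if "z \<in> V" for z using ex[OF that] pI by blast
    show "p (v (j + int k)) = k" if "k < g" for k using that reach_base[of "{v (j + int k)}" ?F] by (intro pI) auto
    fix a b assume ab: "{a, b} \<in> ?F"
    then obtain k where k: "k < g" "a \<in> reach ?F {v (j + int k)}" using ex[of a] edge_in_V by blast
    then have "b \<in> reach ?F {v (j + int k)}" using reach_edge[OF ab] by blast
    then show "p a = p b" using k pI by metis
  qed
qed

lemma perimeter_shift: "perimeter C u = (\<Sum>i<g. u (c (m + int i)))"
proof -
  have step: "(\<Sum>i<g. u (c (m + 1 + int i))) = (\<Sum>i<g. u (c (m + int i)))" for m
  proof -
    have "(\<Sum>i<Suc g. u (c (m + int i))) = u (c m) + (\<Sum>i<g. u (c (m + 1 + int i)))"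
      by (simp add: sum.lessThan_Suc_shift algebra_simps del: sum.lessThan_Suc)
    then show ?thesis by (simp add: c_add_g)
  qed
  have "(\<Sum>i<g. u (c (m + int i))) = (\<Sum>i<g. u (c (1 + int i)))"
  proof (induction m rule: int_induct[of _ 1])
    case (step1 i)
    then show ?case using step[of i] by simp
  next
    case (step2 i)
    then show ?case using step[of "i - 1"] by simp
  qed simp
  also have "\<dots> = perimeter C u"
    unfolding perimeter_def
    by (rule sum.reindex_bij_witness[of _ "\<lambda>i. nat (i - 1)" "\<lambda>k. 1 + int k"]) auto
  finally show ?thesis ..
qed

lemma perimeter_split: "perimeter C u = u (c j) + (\<Sum>i<g - 1. u (c (j + 1 + int i)))"
proof -
  have "perimeter C u = (\<Sum>i<Suc (g - 1). u (c (j + int i)))"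
    using perimeter_shift[of u j] g_ge_3 by simp
  also have "\<dots> = u (c j) + (\<Sum>i<g - 1. u (c (j + 1 + int i)))"
    by (subst sum.lessThan_Suc_shift) (simp add: algebra_simps)
  finally show ?thesis .
qed

lemma three_edge_condition_iff:
  "(\<forall>j\<in>{1..int g}. three_edge_condition C u j) \<longleftrightarrow> (\<forall>j. three_edge_condition C u j)"
proof -
  have "\<exists>k\<in>{1..int g}. three_edge_condition C u i = three_edge_condition C u k" for i
  proof -
    obtain k where k: "k < g" "int g dvd i - (1 + int k)" by (rule index_shift)
    have "c (i + m) = c ((1 + int k) + m)" for m using k(2) by (intro c_eqI) simp
    from this[of 0] this[of 1] this[of "-1"]
    have "three_edge_condition C u i = three_edge_condition C u (1 + int k)"
      by (simp add: three_edge_condition_def)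
    then show ?thesis using k(1) by (intro bexI[of _ "1 + int k"]) auto
  qed
  then show ?thesis by metis
qed

end

section \<open>Potentials on unicyclic graphs\<close>

locale weighted_unicyclic_graph = unicyclic_graph V E C + weighted_graph V E w
  for V :: "'a set" and E C w
begin

text \<open>\<open>B\<close> is the side of \<open>y\<close> after deletion of the bridge. Functions
  defined separately on the two sides then need to be compared only across this one edge.\<close>

lemma pendant_edge_cut:
  assumes "{x, y} \<in> E - range c"
  obtains B where "x \<notin> B" "y \<in> B" "\<And>a b. {a, b} \<in> E \<Longrightarrow> {a, b} \<noteq> {x, y} \<Longrightarrow> a \<in> B \<Longrightarrow> b \<in> B"
proof
  show "x \<notin> reach (E - {{x, y}}) {y}" using assms by (rule pendant_edge_bridge)
  show "y \<in> reach (E - {{x, y}}) {y}" using reach_base by fast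
  show "b \<in> reach (E - {{x, y}}) {y}"
    if "{a, b} \<in> E" "{a, b} \<noteq> {x, y}" "a \<in> reach (E - {{x, y}}) {y}" for a b
    using that by (intro reach_edge[of a b]) auto
qed

lemma d_pendant_edge:
  assumes xy: "{x, y} \<in> E - range c" shows "d x y = w {x, y}"
proof -
  obtain B where B: "x \<notin> B" "y \<in> B" "\<And>a b. {a, b} \<in> E \<Longrightarrow> {a, b} \<noteq> {x, y} \<Longrightarrow> a \<in> B \<Longrightarrow> b \<in> B"
    using pendant_edge_cut[OF xy] by metis
  \<comment> \<open>A step function that jumps by the full weight across the bridge and is constant
    elsewhere.\<close>
  have "edge_lipschitz E w (\<lambda>z. if z \<in> B then w {x, y} else 0)"
    unfolding edge_lipschitz_def
  proof (intro allI impI)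
    fix a b assume ab: "{a, b} \<in> E"
    show "(if b \<in> B then w {x, y} else 0) - (if a \<in> B then w {x, y} else 0) \<le> w {a, b}"
    proof (cases "{a, b} = {x, y}")
      case True
      then show ?thesis using w_pos[OF ab] by simp
    next
      case False
      then have "a \<in> B \<longleftrightarrow> b \<in> B" using B(3)[of a b] B(3)[of b a] ab by (auto simp: insert_commute)
      then show ?thesis using w_pos[OF ab] by simp
    qed
  qed
  from d_ge_lipschitz[OF this, of x y] have "w {x, y} \<le> d x y"
    using B edge_in_V[of x y] xy by simp
  then show ?thesis using d_le_edge[of x y] xy by simp
qed

lemma curvature_pendant_edge:
  assumes xy: "{x, y} \<in> E - range c"
  shows "d x y * lly_curvature E w x y = - excess x y"
proof (rule antisym)
  have xyE: "{x, y} \<in> E" using xy by blast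
  note V = edge_in_V[OF xyE]
  show "- excess x y \<le> d x y * lly_curvature E w x y"
    using lly_curvature_ge[OF xyE, of "{}"] by simp
  obtain B where B: "x \<notin> B" "y \<in> B" "\<And>a b. {a, b} \<in> E \<Longrightarrow> {a, b} \<noteq> {x, y} \<Longrightarrow> a \<in> B \<Longrightarrow> b \<in> B"
    using pendant_edge_cut[OF xy] by metis
  \<comment> \<open>The potential rises with the distance from \<open>y\<close> on the side of
    \<open>y\<close> and falls with the distance from \<open>x\<close> on the other side.\<close>
  define f where "f z = (if z \<in> B then d x y + d y z else - d x z)" for z
  have f0: "f x = 0" "f y = d x y" using B V by (simp_all add: f_def)
  show "d x y * lly_curvature E w x y \<le> - excess x y"
  proof (rule lly_curvature_le_potential[OF xyE])
    show "edge_lipschitz E w f"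
      unfolding edge_lipschitz_def
    proof (intro allI impI)
      fix a b assume ab: "{a, b} \<in> E"
      have ba: "{b, a} \<in> E" using ab by (simp add: insert_commute)
      show "f b - f a \<le> w {a, b}"
      proof (cases "{a, b} = {x, y}")
        case True
        then have "f b - f a \<le> d x y" using f0 d_nonneg[OF V] by (auto simp: doubleton_eq_iff)
        then show ?thesis using d_le_edge[OF xyE] True by simp
      next
        case False
        then have "a \<in> B \<longleftrightarrow> b \<in> B" using B(3)[of a b] B(3)[of b a] ab ba by (auto simp: insert_commute)
        moreover have "d y b - d y a \<le> w {a, b}" using edge_lipschitzD[OF d_edge_lipschitz[OF V(2)] ab] .
        moreover have "d x a - d x b \<le> w {a, b}"
          using edge_lipschitzD[OF d_edge_lipschitz[OF V(1)] ba] by (simp add: insert_commute)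
        ultimately show ?thesis by (auto simp: f_def)
      qed
    qed
    show "f y - f x = d x y" using f0 by simp
    fix u
    show "f u = f x - d x u" if "u \<in> nbrs E x - {y}"
    proof -
      have "u \<notin> B" using B(3)[of u x] B(1) that by (auto simp: in_nbrs insert_commute doubleton_eq_iff)
      then show ?thesis using f0 by (simp add: f_def)
    qed
    show "f u = f y + d y u" if "u \<in> nbrs E y - {x}"
    proof -
      have "u \<in> B" using B(3)[of y u] B(2) that by (auto simp: in_nbrs doubleton_eq_iff)
      then show ?thesis using f0 by (simp add: f_def)
    qed
  qed
qed

text \<open>Values prescribed along the cycle extend into the tree at each cycle vertex as a
  multiple of the distance from its root. The factor \<open>\<sigma> k\<close> decides whether the
  function rises, falls or stays constant there.\<close>

lemma cycle_potential:
  fixes H \<sigma> :: "nat \<Rightarrow> real"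
  assumes step: "\<And>k. Suc k < g \<Longrightarrow> \<bar>H (Suc k) - H k\<bar> \<le> w (c (j + int (Suc k)))"
    and wrap: "\<bar>H 0 - H (g - 1)\<bar> \<le> w (c j)" and \<sigma>: "\<And>k. \<bar>\<sigma> k\<bar> \<le> 1"
  obtains f where "edge_lipschitz E w f" "\<And>k. k < g \<Longrightarrow> f (v (j + int k)) = H k"
    "\<And>k u. k < g \<Longrightarrow> {v (j + int k), u} \<in> E - range c \<Longrightarrow> f u = H k + \<sigma> k * d (v (j + int k)) u"
proof -
  obtain p where p: "\<And>z. z \<in> V \<Longrightarrow> p z < g" "\<And>k. k < g \<Longrightarrow> p (v (j + int k)) = k"
    "\<And>a b. {a, b} \<in> E - range c \<Longrightarrow> p a = p b"
    using cycle_projection by blast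
  define f where "f z = H (p z) + \<sigma> (p z) * d (v (j + int (p z))) z" for z
  have fv: "f (v (j + int k)) = H k" if "k < g" for k
    using p(2)[OF that] v_in_V by (simp add: f_def)
  have fprev: "f (v (j - 1)) = H (g - 1)" and f0: "f (v j) = H 0"
    using fv[of "g - 1"] fv[of 0] g_ge_3 v_prev by auto
  show ?thesis
  proof
    show "f (v (j + int k)) = H k" if "k < g" for k using fv[OF that] .
    show "f u = H k + \<sigma> k * d (v (j + int k)) u"
      if "k < g" "{v (j + int k), u} \<in> E - range c" for k u
      using p(2)[OF that(1)] p(3)[OF that(2)] by (simp add: f_def)
    show "edge_lipschitz E w f"
      unfolding edge_lipschitz_def
    proof (intro allI impI)
      fix a b assume ab: "{a, b} \<in> E"
      have ba: "{b, a} \<in> E" using ab by (simp add: insert_commute)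
      show "f b - f a \<le> w {a, b}"
      proof (cases "{a, b} \<in> range c")
        case False
        then have pab: "p b = p a" using ab p(3)[of a b] by simp
        let ?r = "v (j + int (p a))"
        \<comment> \<open>Both ends of an edge outside the cycle project to the same root, so only
          the distances from that root differ.\<close>
        have "f b - f a = \<sigma> (p a) * (d ?r b - d ?r a)" by (simp add: f_def pab right_diff_distrib)
        also have "\<dots> \<le> \<bar>\<sigma> (p a)\<bar> * \<bar>d ?r b - d ?r a\<bar>" by (metis abs_ge_self abs_mult)
        also have "\<dots> \<le> 1 * \<bar>d ?r b - d ?r a\<bar>" using \<sigma> by (intro mult_right_mono) auto
        also have "\<dots> \<le> w {a, b}"
          using edge_lipschitzD[OF d_edge_lipschitz[OF v_in_V] ab, of "j + int (p a)"]
            edge_lipschitzD[OF d_edge_lipschitz[OF v_in_V] ba, of "j + int (p a)"]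
          by (simp add: insert_commute)
        finally show ?thesis .
      next
        case True
        then obtain i where "{a, b} = c i" by (elim rangeE)
        then obtain k where k: "k < g" "{a, b} = c (j + int k)" using c_shift[of i j] by auto
        show ?thesis
        proof (cases k)
          \<comment> \<open>The edge \<open>c j\<close> closes the cycle: it joins index
            \<open>g - 1\<close> to index 0 and is governed by \<open>wrap\<close>.\<close>
          case 0
          then have cj: "{a, b} = c j" using k(2) by simp
          then have "\<bar>f b - f a\<bar> = \<bar>H 0 - H (g - 1)\<bar>"
            using fprev f0 by (auto simp: c_eq doubleton_eq_iff)
          then show ?thesis using wrap cj by simp
        next
          case (Suc m)
          have "c (j + int (Suc m)) = {v (j + int m), v (j + int (Suc m))}"
            unfolding c_eq by (simp add: algebra_simps)
          then have "\<bar>f b - f a\<bar> = \<bar>H (Suc m) - H m\<bar>"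
            using k Suc fv[of m] fv[of "Suc m"] by (auto simp: doubleton_eq_iff)
          then show ?thesis using step[of m] k Suc by simp
        qed
      qed
    qed
  qed
qed

section \<open>Arc lengths and the lengths of cycle edges\<close>

abbreviation L :: real where "L \<equiv> perimeter C w"

text \<open>The arc starts at \<open>v j\<close> and moves away from \<open>c j\<close>; after
  \<open>g - 1\<close> edges it arrives at \<open>v (j - 1)\<close> with only \<open>c j\<close>
  left out.\<close>

definition arc_len :: "int \<Rightarrow> nat \<Rightarrow> real" where
  "arc_len j k = (\<Sum>i<k. w (c (j + 1 + int i)))"

lemma arc_len_0 [simp]: "arc_len j 0 = 0" by (simp add: arc_len_def)

lemma arc_len_Suc: "arc_len j (Suc k) = arc_len j k + w (c (j + int (Suc k)))"
  by (simp add: arc_len_def algebra_simps)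

lemma w_c_pos: "w (c i) > 0" using w_pos c_in_E by blast

lemma arc_len_nonneg: "arc_len j k \<ge> 0"
  unfolding arc_len_def using w_c_pos by (intro sum_nonneg less_imp_le) auto

lemma arc_len_last: "arc_len j (g - 1) = L - w (c j)"
  using perimeter_split[of w j] by (simp add: arc_len_def)

lemma arc_len_last2: "arc_len j (g - 2) = L - w (c j) - w (c (j - 1))"
proof -
  have "g - 1 = Suc (g - 2)" using g_ge_3 by simp
  then have "arc_len j (g - 1) = arc_len j (g - 2) + w (c (j + int (g - 1)))" using arc_len_Suc by metis
  moreover have "c (j + int (g - 1)) = c (j - 1)" using g_ge_3 by (intro c_eqI) (simp add: of_nat_diff)
  ultimately show ?thesis using arc_len_last by simp
qed

text \<open>This is the arc from \<open>v (j + 1)\<close> to \<open>v (j - 2)\<close> complementary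
  to three consecutive edges; it is empty for a triangle.\<close>

lemma arc_len_inner: "arc_len (j + 1) (g - 3) = L - (w (c (j - 1)) + w (c j) + w (c (j + 1)))"
proof -
  have "g - 2 = Suc (g - 3)" using g_ge_3 by simp
  then have "arc_len j (g - 2) = (\<Sum>i<Suc (g - 3). w (c (j + 1 + int i)))" by (simp add: arc_len_def)
  also have "\<dots> = w (c (j + 1)) + arc_len (j + 1) (g - 3)"
    unfolding arc_len_def by (subst sum.lessThan_Suc_shift) (simp add: algebra_simps)
  finally show ?thesis using arc_len_last2 by simp
qed

lemma d_le_arc_len: "d (v j) (v (j + int k)) \<le> arc_len j k"
proof (induction k)
  case 0
  then show ?case using v_in_V by simp
next
  case (Suc k)
  have c: "c (j + int (Suc k)) = {v (j + int k), v (j + int (Suc k))}"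
    unfolding c_eq by (simp add: algebra_simps)
  have "d (v j) (v (j + int (Suc k))) \<le> d (v j) (v (j + int k)) + d (v (j + int k)) (v (j + int (Suc k)))"
    by (rule d_triangle) (rule v_in_V)+
  also have "\<dots> \<le> arc_len j k + w (c (j + int (Suc k)))"
    using Suc d_le_edge[of "v (j + int k)" "v (j + int (Suc k))"] c_in_E[of "j + int (Suc k)"] c
    by (intro add_mono) auto
  finally show ?case by (simp add: arc_len_Suc)
qed

lemma d_cycle_edge_le: "d (v (j - 1)) (v j) \<le> w (c j)" "d (v (j - 1)) (v j) \<le> L - w (c j)"
proof -
  show "d (v (j - 1)) (v j) \<le> w (c j)"
    using d_le_edge[of "v (j - 1)" "v j"] c_in_E[of j] by (simp add: c_eq)
  show "d (v (j - 1)) (v j) \<le> L - w (c j)"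
    using d_le_arc_len[of j "g - 1"] d_commute[OF v_in_V v_in_V, of j "j - 1"] v_prev[of j] arc_len_last[of j] by simp
qed

lemma d_cycle_edge_ge: "min (w (c j)) (L - w (c j)) \<le> d (v (j - 1)) (v j)"
proof -
  define M where "M = min (w (c j)) (L - w (c j))"
  have "L - w (c j) \<ge> 0" using arc_len_nonneg[of j "g - 1"] unfolding arc_len_last .
  then have M: "0 \<le> M" "M \<le> w (c j)" "M \<le> L - w (c j)" using w_c_pos[of j] by (auto simp: M_def)
  \<comment> \<open>The arc length from \<open>v j\<close>, truncated at \<open>M\<close>. Since
    \<open>M\<close> is at most \<open>L - w (c j)\<close>, the value \<open>M\<close> is attained
    at \<open>v (j - 1)\<close>; since \<open>M\<close> is at most \<open>w (c j)\<close>, the drop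
    across \<open>c j\<close> is admissible.\<close>
  define H where "H k = min (arc_len j k) M" for k
  have "\<bar>H (Suc k) - H k\<bar> \<le> w (c (j + int (Suc k)))" for k
    using w_c_pos[of "j + int (Suc k)"] unfolding H_def arc_len_Suc by linarith
  moreover have "\<bar>H 0 - H (g - 1)\<bar> \<le> w (c j)"
    using M unfolding H_def arc_len_last by simp
  ultimately obtain f where f: "edge_lipschitz E w f" "\<And>k. k < g \<Longrightarrow> f (v (j + int k)) = H k"
    by (rule cycle_potential[where \<sigma> = "\<lambda>_. 0"]) auto
  have "f (v (j - 1)) = M" "f (v j) = 0"
    using f(2)[of "g - 1"] f(2)[of 0] g_ge_3 M v_prev[of j] arc_len_last[of j] by (auto simp: H_def)
  then show ?thesis
    using d_ge_lipschitz[OF f(1), of "v j" "v (j - 1)"] d_commute[of "v j" "v (j - 1)"] v_in_V by (simp add: M_def)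
qed

lemma d_cycle_edge: "w (c j) \<le> L / 2 \<Longrightarrow> d (v (j - 1)) (v j) = w (c j)"
  using d_cycle_edge_ge[of j] d_cycle_edge_le[of j] by simp

lemma geodesic_weighting_iff: "geodesic_weighting C w \<longleftrightarrow> (\<forall>i. w (c i) \<le> L / 2)"
proof -
  have "\<exists>k\<in>{1..int g}. c i = c k" for i
    using range_c by (metis imageE rangeI)
  then show ?thesis unfolding geodesic_weighting_def by metis
qed

lemma d_edge:
  assumes "geodesic_weighting C w" "{a, b} \<in> E" shows "d a b = w {a, b}"
proof (cases "{a, b} \<in> range c")
  case True
  then obtain i where i: "{a, b} = c i" by (elim rangeE)
  have "d (v (i - 1)) (v i) = w (c i)" "d (v i) (v (i - 1)) = w (c i)"
    using d_cycle_edge[of i] assms(1) d_commute[of "v i" "v (i - 1)"] v_in_V by (auto simp: geodesic_weighting_iff)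
  then have "d a b = w (c i)" using i by (auto simp: c_eq doubleton_eq_iff)
  then show ?thesis using i by simp
qed (use d_pendant_edge assms in blast)

lemma curvature_cycle_edge:
  assumes geod: "geodesic_weighting C w"
  shows "d (v (j - 1)) (v j) * lly_curvature E w (v (j - 1)) (v j) = - excess (v (j - 1)) (v j)
      \<longleftrightarrow> three_edge_condition C w j"
proof
  note dE = d_edge[OF geod]
  have xy: "{v (j - 1), v j} \<in> E" using c_in_E[of j] by (simp add: c_eq)
  have c1: "c (j + 1) = {v j, v (j + 1)}" and c2: "c (j - 1) = {v (j - 2), v (j - 1)}"
    by (simp_all add: c_eq)
  have e1: "{v j, v (j + 1)} \<in> E" and e2: "{v (j - 1), v (j - 2)} \<in> E"
    using c_in_E[of "j + 1"] c_in_E[of "j - 1"] c1 c2 by (simp_all add: insert_commute)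
  have dj: "d (v (j - 1)) (v j) = w (c j)" using dE[OF xy] by (simp add: c_eq)
  have d1: "d (v j) (v (j + 1)) = w (c (j + 1))" using dE[OF e1] c1 by simp
  have d2: "d (v (j - 1)) (v (j - 2)) = w (c (j - 1))" using dE[OF e2] c2 by (simp add: insert_commute)
  have prev2: "v (j - 2) = v (j + int (g - 2))"
    using g_ge_3 by (subst v_eq_iff) (simp add: of_nat_diff)
  {
    assume eq: "d (v (j - 1)) (v j) * lly_curvature E w (v (j - 1)) (v j) = - excess (v (j - 1)) (v j)"
    let ?T = "w (c (j - 1)) + w (c j) + w (c (j + 1)) - d (v (j - 2)) (v (j + 1))"
    \<comment> \<open>The outer end points of the three edges are served directly. Equality in the
      tree formula leaves no saving, so the three edges are no longer than any path between these
      end points, in particular the complementary arc. In a triangle the two end points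
      coincide.\<close>
    have "{(v (j - 2), v (j + 1))} \<subseteq> (nbrs E (v (j - 1)) - {v j}) \<times> (nbrs E (v j) - {v (j - 1)})"
      using e1 e2 g_ge_3 v_neq[of "j - 2" j] v_neq[of "j + 1" "j - 1"] by (auto simp: in_nbrs)
    from lly_curvature_ge[OF xy this]
    have "?T / (real (deg E (v (j - 1))) * real (deg E (v j))) \<le> 0"
      using eq dj d1 d2 by simp
    moreover have "real (deg E (v (j - 1))) * real (deg E (v j)) > 0" using deg_pos xy e1 by simp
    ultimately have "?T \<le> 0" by (simp only: pos_divide_le_eq mult_zero_left)
    moreover have "d (v (j + 1)) (v (j - 2)) \<le> arc_len (j + 1) (g - 3)"
    proof -
      have "v (j - 2) = v (j + 1 + int (g - 3))"
        using g_ge_3 by (subst v_eq_iff) (simp add: of_nat_diff)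
      then show ?thesis using d_le_arc_len[of "j + 1" "g - 3"] by simp
    qed
    ultimately have "?T \<le> 0" "d (v (j - 2)) (v (j + 1)) \<le> L - (w (c (j - 1)) + w (c j) + w (c (j + 1)))"
      using d_commute[OF v_in_V v_in_V, of "j + 1" "j - 2"] arc_len_inner by auto
    then show "three_edge_condition C w j" unfolding three_edge_condition_def by simp
  next
    assume three: "three_edge_condition C w j"
    define A B D where "A = w (c j)" and "B = w (c (j + 1))" and "D = w (c (j - 1))"
    have pos: "A > 0" "B > 0" "D > 0" using w_c_pos by (simp_all add: A_def B_def D_def)
    have le: "2 * (A + B + D) \<le> L" using three by (simp add: three_edge_condition_def A_def B_def D_def)
    \<comment> \<open>Starting from \<open>v j\<close>, \<open>H\<close> rises with slope 1 up to \<open>v (j + 1)\<close>, then falls with slope -1 until it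
      meets the line of slope 1 through the values \<open>- D\<close> at \<open>v (j - 2)\<close> and \<open>0\<close> at \<open>v (j - 1)\<close>; the
      three-edge condition leaves enough room for the descent.\<close>
    define H where "H k = max (min (A + arc_len j k) (A + 2 * B - arc_len j k)) (arc_len j k - (L - A))" for k
    \<comment> \<open>Index \<open>g - 1\<close> is \<open>v (j - 1)\<close>, where the potential
      has to fall into the attached trees; at index 0, which is \<open>v j\<close>, it has to
      rise.\<close>
    define \<sigma> :: "nat \<Rightarrow> real" where "\<sigma> k = (if k = g - 1 then -1 else 1)" for k
    \<comment> \<open>At index \<open>g - 2\<close> the descending branch is
      \<open>2 * A + 2 * B + D - L\<close>; that it is at most \<open>- D\<close> is exactly the
      three-edge condition.\<close>
    have H0: "H 0 = A" and Hl: "H (g - 1) = 0" and H1: "H 1 = A + B" and H2: "H (g - 2) = - D"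
      using pos le arc_len_Suc[of j 0] arc_len_last[of j] arc_len_last2[of j]
      by (simp_all add: H_def A_def[symmetric] B_def[symmetric] D_def[symmetric])
    have "\<bar>H (Suc k) - H k\<bar> \<le> w (c (j + int (Suc k)))" for k
      using w_c_pos[of "j + int (Suc k)"] unfolding H_def arc_len_Suc by linarith
    moreover have "\<bar>H 0 - H (g - 1)\<bar> \<le> w (c j)" using pos unfolding H0 Hl by (simp add: A_def)
    ultimately obtain f where f: "edge_lipschitz E w f" "\<And>k. k < g \<Longrightarrow> f (v (j + int k)) = H k"
      "\<And>k u. k < g \<Longrightarrow> {v (j + int k), u} \<in> E - range c \<Longrightarrow> f u = H k + \<sigma> k * d (v (j + int k)) u"
      by (rule cycle_potential[where \<sigma> = \<sigma>]) (auto simp: \<sigma>_def)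
    have fx: "f (v (j - 1)) = 0" and fy: "f (v j) = A" and f1: "f (v (j + 1)) = A + B" and f2: "f (v (j - 2)) = - D"
      using f(2)[of "g - 1"] f(2)[of 0] f(2)[of 1] f(2)[of "g - 2"] g_ge_3 H0 H1 Hl H2 v_prev[of j] prev2
      by simp_all
    show "d (v (j - 1)) (v j) * lly_curvature E w (v (j - 1)) (v j) = - excess (v (j - 1)) (v j)"
    proof (rule antisym)
      show "- excess (v (j - 1)) (v j) \<le> d (v (j - 1)) (v j) * lly_curvature E w (v (j - 1)) (v j)"
        using lly_curvature_ge[OF xy, of "{}"] by simp
      show "d (v (j - 1)) (v j) * lly_curvature E w (v (j - 1)) (v j) \<le> - excess (v (j - 1)) (v j)"
      proof (rule lly_curvature_le_potential[OF xy f(1)])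
        show "f (v j) - f (v (j - 1)) = d (v (j - 1)) (v j)" using fx fy dj by (simp add: A_def)
        fix u
        show "f u = f (v (j - 1)) - d (v (j - 1)) u" if "u \<in> nbrs E (v (j - 1)) - {v j}"
        proof (cases "{v (j - 1), u} \<in> range c")
          case True
          then have "u = v (j - 2)" using cycle_nbr[OF True] that by auto
          then show ?thesis using f2 fx d2 by (simp add: D_def)
        next
          case False
          then have "{v (j + int (g - 1)), u} \<in> E - range c"
            using that v_prev[of j] by (simp add: in_nbrs)
          from f(3)[OF _ this] show ?thesis using g_ge_3 fx Hl v_prev[of j] by (simp add: \<sigma>_def)
        qed
        show "f u = f (v j) + d (v j) u" if "u \<in> nbrs E (v j) - {v (j - 1)}"
        proof (cases "{v j, u} \<in> range c")
          case True
          then have "u = v (j + 1)" using cycle_nbr[OF True] that by auto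
          then show ?thesis using f1 fy d1 by (simp add: B_def)
        next
          case False
          then have "{v (j + int 0), u} \<in> E - range c" using that by (simp add: in_nbrs)
          from f(3)[OF _ this] show ?thesis using g_ge_3 fy H0 by (simp add: \<sigma>_def)
        qed
      qed
    qed
  }
qed

section \<open>Einstein metrics and the Perron eigenvector\<close>

lemma three_edge_condition_less: "three_edge_condition C w j \<Longrightarrow> w (c j) < L / 2"
  using w_c_pos[of "j - 1"] w_c_pos[of "j + 1"] by (simp add: three_edge_condition_def)

lemma edge_length_le: "e \<in> E \<Longrightarrow> edge_length e \<le> w e"
  by (erule edgeE) (simp add: edge_length d_le_edge)

lemma edge_length_cycle: "edge_length (c j) = d (v (j - 1)) (v j)"
  using c_in_E[of j] by (simp add: c_eq edge_length)

text \<open>Only a cycle edge heavier than the rest of the cycle is shortened. Its length would then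
  be the total weight of the others, hence at least half of the perimeter measured in
  lengths.\<close>

lemma edge_length_eqI:
  assumes "\<And>j. edge_length (c j) < perimeter C edge_length / 2" and "e \<in> E"
  shows "edge_length e = w e"
proof (cases "e \<in> range c")
  case True
  then obtain j where j: "e = c j" by (elim rangeE)
  have "edge_length (c j) < (\<Sum>i<g - 1. edge_length (c (j + 1 + int i)))"
    using assms(1)[of j] perimeter_split[of edge_length j] by simp
  also have "\<dots> \<le> (\<Sum>i<g - 1. w (c (j + 1 + int i)))"
    by (intro sum_mono edge_length_le c_in_E)
  finally have "edge_length (c j) < L - w (c j)" using perimeter_split[of w j] by simp
  then show ?thesis
    using d_cycle_edge_ge[of j] d_cycle_edge_le(1)[of j] j by (simp add: edge_length_cycle)
next
  case False
  obtain x y where "e = {x, y}" "{x, y} \<in> E" using assms(2) by (rule edgeE)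
  then show ?thesis using False d_pendant_edge[of x y] by (simp add: edge_length)
qed

text \<open>The rest of the cycle is a path between the ends of \<open>c i\<close>, so an edge as
  long as its weight weighs at most \<open>L - w (c i)\<close>.\<close>

lemma geodesic_weightingI: "(\<And>e. e \<in> E \<Longrightarrow> edge_length e = w e) \<Longrightarrow> geodesic_weighting C w"
  using d_cycle_edge_le(2) c_in_E unfolding geodesic_weighting_iff edge_length_cycle[symmetric]
  by (smt (verit) field_sum_of_halves)

text \<open>For an eigenvector the tree formula takes the same value \<open>- k\<close> on every
  edge, so being Einstein with this constant means obeying the tree formula everywhere.\<close>

lemma curvature_eigen:
  assumes geod: "geodesic_weighting C w" and xy: "{x, y} \<in> E"
    and eig: "\<And>e. e \<in> E \<Longrightarrow> (\<Sum>e'\<in>E. ricci_matrix E e e' * w e') = k * w e"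
  shows "lly_curvature E w x y = - k \<longleftrightarrow> d x y * lly_curvature E w x y = - excess x y"
proof -
  have len: "edge_length e = w e" if "e \<in> E" for e
    using that by (rule edgeE) (simp add: edge_length d_edge[OF geod])
  have "excess x y = (\<Sum>e\<in>E. ricci_matrix E {x, y} e * w e)"
    unfolding excess_ricci[OF xy] by (rule sum.cong) (simp_all add: len)
  also have "\<dots> = d x y * k" using eig[OF xy] d_edge[OF geod xy] by simp
  finally have "- excess x y = d x y * (- k)" by simp
  then show ?thesis using d_edge_pos[OF xy] by (simp only: mult_cancel_left) simp
qed

lemma einstein_iff_three_edge:
  assumes eig: "\<And>e. e \<in> E \<Longrightarrow> (\<Sum>e'\<in>E. ricci_matrix E e e' * w e') = k * w e"
  shows "discrete_einstein E w (- k) \<longleftrightarrow> (\<forall>j. three_edge_condition C w j)"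
proof
  assume ein: "discrete_einstein E w (- k)"
  have E: "E \<noteq> {}" using c_in_E by blast
  \<comment> \<open>An Einstein metric need not be geodesic a priori. First the lengths are shown
    proportional to the weights, then the factor is shown to be 1.\<close>
  obtain b where b: "b > 0" "\<forall>e\<in>E. edge_length e = b * w e"
    using einstein_edge_length[OF ein E w_pos eig] by blast
  \<comment> \<open>The lightest edge is a shortest path.\<close>
  have "b = 1"
  proof -
    have "Min (w ` E) \<in> w ` E" using finite_E E by (intro Min_in) auto
    then obtain e where e: "e \<in> E" "w e = Min (w ` E)" by auto
    obtain x y where xy: "e = {x, y}" "x \<noteq> y" "{x, y} \<in> E" using e(1) by (rule edgeE)
    have "w e \<le> d x y"
      using e finite_E w_pos[OF e(1)] xy edge_in_V[OF xy(3)] by (intro d_ge_min) auto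
    then have "edge_length e = w e" using d_le_edge[OF xy(3)] xy by (simp add: edge_length)
    then show ?thesis using b(2) e(1) w_pos[OF e(1)] by simp
  qed
  then have geod: "geodesic_weighting C w" using b(2) by (intro geodesic_weightingI) simp
  show "\<forall>j. three_edge_condition C w j"
  proof
    fix j
    have xy: "{v (j - 1), v j} \<in> E" using c_in_E[of j] by (simp add: c_eq)
    then have "lly_curvature E w (v (j - 1)) (v j) = - k"
      using ein by (simp add: discrete_einstein_def)
    then show "three_edge_condition C w j"
      using curvature_eigen[OF geod xy eig] curvature_cycle_edge[OF geod] by blast
  qed
next
  assume three: "\<forall>j. three_edge_condition C w j"
  then have geod: "geodesic_weighting C w"
    using three_edge_condition_less by (auto simp: geodesic_weighting_iff less_imp_le)
  have "lly_curvature E w x y = - k" if xy: "{x, y} \<in> E" for x y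
  proof (cases "{x, y} \<in> range c")
    case True
    then obtain j where j: "{x, y} = c j" by (elim rangeE)
    have xy': "{v (j - 1), v j} \<in> E" using c_in_E[of j] by (simp add: c_eq)
    have "lly_curvature E w (v (j - 1)) (v j) = - k"
      using curvature_eigen[OF geod xy' eig] curvature_cycle_edge[OF geod] three by blast
    \<comment> \<open>The Einstein condition ranges over ordered pairs, so both orientations of the
      cycle edge occur.\<close>
    moreover have "x = v (j - 1) \<and> y = v j \<or> x = v j \<and> y = v (j - 1)"
      using j by (simp add: c_eq doubleton_eq_iff)
    ultimately show ?thesis using lly_curvature_commute[OF xy'] by auto
  next
    case False
    then show ?thesis
      using curvature_eigen[OF geod xy eig] curvature_pendant_edge[of x y] xy by blast
  qed
  then show "discrete_einstein E w (- k)" using pos by (simp add: discrete_einstein_def)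
qed

end

theorem theoremA:
  fixes V :: "'a set" and E :: "'a set set" and C :: "'a list"
  assumes "unicyclic V E" and "is_cycle E C"
  shows
    "(\<forall>w. positive_weighting E w \<and> geodesic_weighting C w \<longrightarrow>
        (\<forall>j\<in>{1..int (length C)}.
           obeys_tree_formula E w (cyc_vertex C (j - 1)) (cyc_vertex C j)
             \<longleftrightarrow> three_edge_condition C w j) \<and>
        (\<forall>x y. {x, y} \<in> E - cyc_edge C ` {1..int (length C)} \<longrightarrow> obeys_tree_formula E w x y))
     \<and>
     (\<forall>w'. perron_eigenvector E w' \<longrightarrow>
        (discrete_einstein E w' (- ricci_lambda_max E)
           \<longleftrightarrow> (\<forall>j\<in>{1..int (length C)}. three_edge_condition C w' j)) \<and>
        ((\<forall>j\<in>{1..int (length C)}. three_edge_condition C w' j) \<longrightarrow>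
           (\<forall>w \<kappa>. discrete_einstein E w \<kappa> \<longrightarrow> (\<exists>c>0. \<forall>e\<in>E. w e = c * w' e))))"
proof -
  interpret U: unicyclic_graph V E C
    using assms by unfold_locales (auto simp: unicyclic_def)
  have weighted: "weighted_unicyclic_graph V E C w" if "positive_weighting E w" for w
    using that by unfold_locales
  have part1: "(\<forall>j\<in>{1..int (length C)}.
           obeys_tree_formula E w (cyc_vertex C (j - 1)) (cyc_vertex C j)
             \<longleftrightarrow> three_edge_condition C w j) \<and>
        (\<forall>x y. {x, y} \<in> E - cyc_edge C ` {1..int (length C)} \<longrightarrow> obeys_tree_formula E w x y)"
    if "positive_weighting E w" and geod: "geodesic_weighting C w" for w
  proof -
    interpret W: weighted_unicyclic_graph V E C w using that(1) by (rule weighted)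
    note iff = W.obeys_tree_formula_iff[OF _ W.d_edge[OF geod]]
    have "obeys_tree_formula E w (U.v (j - 1)) (U.v j) \<longleftrightarrow> three_edge_condition C w j" for j
      using iff[of "U.v (j - 1)" "U.v j"] U.c_in_E[of j] W.curvature_cycle_edge[OF geod] by (simp add: U.c_eq)
    moreover have "obeys_tree_formula E w x y" if "{x, y} \<in> E - range U.c" for x y
      using iff[of x y] W.curvature_pendant_edge[OF that] that by blast
    ultimately show ?thesis unfolding U.range_c by blast
  qed
  have part2: "(discrete_einstein E w' (- ricci_lambda_max E)
           \<longleftrightarrow> (\<forall>j\<in>{1..int (length C)}. three_edge_condition C w' j)) \<and>
        ((\<forall>j\<in>{1..int (length C)}. three_edge_condition C w' j) \<longrightarrow>
           (\<forall>w \<kappa>. discrete_einstein E w \<kappa> \<longrightarrow> (\<exists>c>0. \<forall>e\<in>E. w e = c * w' e)))"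
    if perron: "perron_eigenvector E w'" for w'
  proof -
    define k where "k = ricci_lambda_max E"
    have pos: "positive_weighting E w'" using perron by (simp add: perron_eigenvector_def)
    interpret P: weighted_unicyclic_graph V E C w' using pos by (rule weighted)
    have eig: "(\<Sum>e'\<in>E. ricci_matrix E e e' * w' e') = k * w' e" if "e \<in> E" for e
      using perron that by (simp add: perron_eigenvector_def ricci_eigenvector_def k_def)
    have E: "E \<noteq> {}" using U.c_in_E by blast
    have "\<exists>b>0. \<forall>e\<in>E. w e = b * w' e"
      if three: "\<forall>j. three_edge_condition C w' j" and ein: "discrete_einstein E w \<kappa>" for w \<kappa>
    proof -
      have "positive_weighting E w" using ein by (simp add: discrete_einstein_def)
      then interpret W: weighted_unicyclic_graph V E C w by (rule weighted)
      have wg: "weighted_graph V E w" "weighted_graph V E w'" by unfold_locales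
      have ein': "discrete_einstein E w' (- k)" using three P.einstein_iff_three_edge[OF eig] by blast
      \<comment> \<open>The Perron weighting is Einstein by the three-edge condition, so comparing
        in both directions fixes the unknown curvature.\<close>
      have "\<kappa> = - k"
        using einstein_curvature_le[OF wg E ein ein'] einstein_curvature_le[OF wg(2,1) E ein' ein] by simp
      then have "discrete_einstein E w (- k)" using ein by simp
      from W.einstein_edge_length[OF this E P.w_pos eig]
      obtain b where b: "b > 0" "\<forall>e\<in>E. W.edge_length e = b * w' e" by blast
      have bc: "W.edge_length (U.c j) = b * w' (U.c j)" for j using b(2) U.c_in_E by blast
      then have "perimeter C W.edge_length = b * P.L"
        by (simp add: perimeter_def sum_distrib_left)
      \<comment> \<open>The strict half-perimeter bound for \<open>w'\<close> is invariant under
        scaling and so holds for the lengths of \<open>w\<close>; hence no edge of \<open>w\<close>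
        is shortened.\<close>
      then have "W.edge_length (U.c j) < perimeter C W.edge_length / 2" for j
        using P.three_edge_condition_less[of j] three b(1) by (simp add: bc)
      then have "\<forall>e\<in>E. w e = b * w' e" using W.edge_length_eqI b(2) by simp
      then show ?thesis using b(1) by blast
    qed
    then show ?thesis
      using P.einstein_iff_three_edge[OF eig] U.three_edge_condition_iff[of w'] unfolding k_def by blast
  qed
  show ?thesis using part1 part2 by blast
qed

end
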